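(* Let $(M^4,g(t))_{t\in[0,T)}$ be a solution to Ricci flow satisfying the basic assumptions, and let $R,v,\varepsilon_0$ be the fixed constants described in the context. For all good times $t\in(T-v,T)$ and all $p\in\mathrm{Reg}_t(M)$ we have $$\tfrac18\,d(x,y,r)\le d(x,y,s)\le 8\,d(x,y,r)$$ for all $r,s\in[t,T)$ and all $x,y\in{}^tB_{\frac R{200}\sqrt{T-t}}(p)$.
   Context: Basic assumptions: $M^4$ is a smooth, compact, connected four-dimensional manifold without boundary; $(M^4,g(t))_{t\in[0,T)}$ is a smooth solution of the Ricci flow $\partial_t g=-2\,\mathrm{Ricci}(g)$; $T<\infty$; and the scalar curvature satisfies $\sup_{M\times[0,T)}|\mathrm R|\le1$. Notation: $d(x,y,t)$ is the Riemannian distance between $x,y\in M$ with respect to $g(t)$; ${}^tB_r(p)$ is the open ball of radius $r$ about $p$ with respect to $d(\cdot,\cdot,t)$. Good time: $t\in[0,T)$ is a good time if $\int_M|\mathrm{Rc}|^4(\cdot,t)\,d\mu_{g(t)}\le\frac1{T-t}$. Regular points: $\mathrm{Reg}(M)$ is the set of $p\in M$ for which there is $r=r(p)>0$ with $\int_{{}^tB_r(p)}|\mathrm{Riem}|^2(\cdot,t)\,d\mu_{g(t)}\le\varepsilon_0$ for all $t\in[0,T)$. For $t\in(0,T)$, $\mathrm{Reg}_t(M)$ is the set of $p\in M$ with $\int_{{}^tB_{R\sqrt{T-t}}(p)}|\mathrm{Riem}|^2(\cdot,t)\,d\mu_{g(t)}\le\varepsilon_0$. Fixed constants: $R>0$ (large)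 and $v,\varepsilon_0>0$ (small), depending only on $(M,g(0))$ and $T$, are fixed with the following property (such constants exist by an earlier theorem of the paper): whenever $t$ is a good time with $|T-t|\le v$ and $p\in\mathrm{Reg}_t(M)$, then $p$ and all points of ${}^tB_{\frac R2\sqrt{T-t}}(p)$ lie in $\mathrm{Reg}(M)$, and on ${}^tB_{\frac R2\sqrt{T-t}}(p)$ one has, for all $r,s\in[t,T)$, $\frac12g(r)\le g(s)\le2g(r)$ and $e^{-\theta}g(r)\le g(s)\le e^{\theta}g(r)$ with $\theta=8|(r-t)^{1/4}-(s-t)^{1/4}|/(T-t)^{1/4}$. *)

theory Defs
  imports "HOL-Analysis.Analysis"
begin

section \<open>Smooth manifolds given by an atlas\<close>

text \<open>
  The manifold is the whole type \<^typ>\<open>'m\<close>.  A chart is a pair of its domain and a map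
  to \<open>\<real>\<^sup>n\<close>, whose values outside the domain are irrelevant.
\<close>

type_synonym ('m, 'n) chart = "'m set \<times> ('m \<Rightarrow> real^'n)"

abbreviation chart_inv :: "('m, 'n) chart \<Rightarrow> real^'n \<Rightarrow> 'm" where
  "chart_inv c \<equiv> inv_into (fst c) (snd c)"

abbreviation chart_image :: "('m, 'n) chart \<Rightarrow> (real^'n) set" where
  "chart_image c \<equiv> snd c ` fst c"

text \<open>
  The derivatives are taken within \<open>S\<close>.  The definition is used only for \<open>S\<close> open and for
  \<open>S = [0,T) \<times> V\<close> with \<open>V\<close> open; there the derivative within \<open>S\<close> is unique, and at time \<open>0\<close>
  it is one-sided in time.
\<close>

primrec Ck_on :: "nat \<Rightarrow> 'a::euclidean_space set \<Rightarrow> ('a \<Rightarrow> 'b::real_normed_vector) \<Rightarrow> bool" where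
  "Ck_on 0 S f \<longleftrightarrow> continuous_on S f"
| "Ck_on (Suc k) S f \<longleftrightarrow> f differentiable_on S \<and>
     (\<forall>i\<in>Basis. Ck_on k S (\<lambda>x. frechet_derivative f (at x within S) i))"

definition smooth_on :: "'a::euclidean_space set \<Rightarrow> ('a \<Rightarrow> 'b::real_normed_vector) \<Rightarrow> bool" where
  "smooth_on S f \<longleftrightarrow> (\<forall>k. Ck_on k S f)"

definition smooth_atlas :: "('m::topological_space, 'n::finite) chart set \<Rightarrow> bool" where
  "smooth_atlas A \<longleftrightarrow>
     (\<Union>c\<in>A. fst c) = UNIV \<and>
     (\<forall>c\<in>A. open (fst c) \<and> open (chart_image c) \<and>
        homeomorphism (fst c) (chart_image c) (snd c) (chart_inv c)) \<and>
     (\<forall>c\<in>A. \<forall>c'\<in>A. smooth_on (snd c ` (fst c \<inter> fst c')) (snd c' \<circ> chart_inv c))"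

text \<open>
  Compactness makes second countability automatic, so together with the Hausdorff class
  these are all the requirements on a closed connected manifold.
\<close>

definition closed_manifold :: "('m::t2_space, 'n::finite) chart set \<Rightarrow> bool" where
  "closed_manifold A \<longleftrightarrow>
     smooth_atlas A \<and> compact (UNIV :: 'm set) \<and> connected (UNIV :: 'm set)"

definition chart_at :: "('m, 'n) chart set \<Rightarrow> 'm \<Rightarrow> ('m, 'n) chart" where
  "chart_at A p = (SOME c. c \<in> A \<and> p \<in> fst c)"


section \<open>Riemannian metrics\<close>

text \<open>
  A covariant 2-tensor field is given by its component matrices: \<open>h c p $ i $ j\<close> is
  \<open>h\<^sub>i\<^sub>j\<close> at the point \<open>p\<close> in the chart \<open>c\<close>.  The last condition below is the
  transformation law that makes the components in different charts one tensor field.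
\<close>

type_synonym ('m, 'n) tensor2 = "('m, 'n) chart \<Rightarrow> 'm \<Rightarrow> real^'n^'n"

definition riemannian_metric ::
    "('m::topological_space, 'n::finite) chart set \<Rightarrow> ('m, 'n) tensor2 \<Rightarrow> bool" where
  "riemannian_metric A h \<longleftrightarrow>
     (\<forall>c\<in>A. smooth_on (chart_image c) (\<lambda>x. h c (chart_inv c x))) \<and>
     (\<forall>c\<in>A. \<forall>p\<in>fst c. transpose (h c p) = h c p \<and> (\<forall>w. w \<noteq> 0 \<longrightarrow> w \<bullet> (h c p *v w) > 0)) \<and>
     (\<forall>c\<in>A. \<forall>c'\<in>A. \<forall>p\<in>fst c \<inter> fst c'.
        let J = jacobian (snd c' \<circ> chart_inv c) (at (snd c p))
        in h c p = transpose J ** h c' p ** J)"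

definition form_le :: "real^'n^'n \<Rightarrow> real^'n^'n \<Rightarrow> bool" where
  "form_le P Q \<longleftrightarrow> (\<forall>w. w \<bullet> (P *v w) \<le> w \<bullet> (Q *v w))"

definition metric_le_at ::
    "('m, 'n::finite) chart set \<Rightarrow> 'm \<Rightarrow> real \<Rightarrow> ('m, 'n) tensor2 \<Rightarrow> real \<Rightarrow> ('m, 'n) tensor2 \<Rightarrow> bool" where
  "metric_le_at A p a h b k \<longleftrightarrow>
     (\<forall>c\<in>A. p \<in> fst c \<longrightarrow> form_le (a *\<^sub>R h c p) (b *\<^sub>R k c p))"


subsection \<open>Riemannian distance\<close>

definition C1_curve ::
    "('m::topological_space, 'n::finite) chart set \<Rightarrow> (real \<Rightarrow> 'm) \<Rightarrow> real \<Rightarrow> real \<Rightarrow> bool" where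
  "C1_curve A \<gamma> a b \<longleftrightarrow> continuous_on {a..b} \<gamma> \<and>
     (\<forall>c\<in>A. let S = {s\<in>{a..b}. \<gamma> s \<in> fst c} in
        \<exists>D. continuous_on S D \<and>
          (\<forall>s\<in>S. ((snd c \<circ> \<gamma>) has_vector_derivative D s) (at s within S)))"

definition piecewise_C1_curve ::
    "('m::topological_space, 'n::finite) chart set \<Rightarrow> (real \<Rightarrow> 'm) \<Rightarrow> real \<Rightarrow> real \<Rightarrow> bool" where
  "piecewise_C1_curve A \<gamma> a b \<longleftrightarrow> continuous_on {a..b} \<gamma> \<and>
     (\<exists>P. finite P \<and> {a, b} \<subseteq> P \<and> P \<subseteq> {a..b} \<and>
        (\<forall>u\<in>P. \<forall>w\<in>P. u < w \<and> {u<..<w} \<inter> P = {} \<longrightarrow> C1_curve A \<gamma> u w))"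

text \<open>By the transformation law, the speed does not depend on the chart that is chosen.\<close>

definition speed ::
    "('m, 'n::finite) chart set \<Rightarrow> ('m, 'n) tensor2 \<Rightarrow> (real \<Rightarrow> 'm) \<Rightarrow> real \<Rightarrow> real" where
  "speed A h \<gamma> s =
     (let c = chart_at A (\<gamma> s); w = vector_derivative (snd c \<circ> \<gamma>) (at s)
      in sqrt (w \<bullet> (h c (\<gamma> s) *v w)))"

text \<open>The speed is meaningless at the finitely many break points, which do not affect the integral.\<close>

definition curve_length ::
    "('m, 'n::finite) chart set \<Rightarrow> ('m, 'n) tensor2 \<Rightarrow> (real \<Rightarrow> 'm) \<Rightarrow> real \<Rightarrow> real \<Rightarrow> real" where
  "curve_length A h \<gamma> a b = integral {a..b} (speed A h \<gamma>)"

definition rdist ::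
    "('m::topological_space, 'n::finite) chart set \<Rightarrow> ('m, 'n) tensor2 \<Rightarrow> 'm \<Rightarrow> 'm \<Rightarrow> real" where
  "rdist A h x y =
     Inf {curve_length A h \<gamma> a b | \<gamma> a b.
            a < b \<and> piecewise_C1_curve A \<gamma> a b \<and> \<gamma> a = x \<and> \<gamma> b = y}"

definition rball ::
    "('m::topological_space, 'n::finite) chart set \<Rightarrow> ('m, 'n) tensor2 \<Rightarrow> 'm \<Rightarrow> real \<Rightarrow> 'm set" where
  "rball A h p r = {q. rdist A h p q < r}"


subsection \<open>Volume measure\<close>

text \<open>
  The Riemannian measure is the unique Borel measure that has density \<open>\<surd>det h\<close> with respect
  to Lebesgue measure in each chart.
\<close>

definition vol :: "('m::topological_space, 'n::finite) chart set \<Rightarrow> ('m, 'n) tensor2 \<Rightarrow> 'm measure" where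
  "vol A h = (THE \<mu>. sets \<mu> = sets borel \<and>
     (\<forall>c\<in>A. \<forall>B\<in>sets borel. B \<subseteq> fst c \<longrightarrow>
        emeasure \<mu> B =
          (\<integral>\<^sup>+x\<in>snd c ` B. ennreal (sqrt (det (h c (chart_inv c x)))) \<partial>lborel)))"


subsection \<open>Curvature\<close>

text \<open>In this part \<open>G\<close> is the matrix of metric components in the fixed chart \<open>c\<close>.\<close>

definition chart_partial :: "('m, 'n::finite) chart \<Rightarrow> 'n \<Rightarrow> ('m \<Rightarrow> real) \<Rightarrow> 'm \<Rightarrow> real" where
  "chart_partial c i f p =
     frechet_derivative (f \<circ> chart_inv c) (at (snd c p)) (axis i 1)"

text \<open>\<open>christoffel c G l i j\<close> is \<open>\<Gamma>\<^sup>l\<^sub>i\<^sub>j\<close>.\<close>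

definition christoffel ::
    "('m, 'n::finite) chart \<Rightarrow> ('m \<Rightarrow> real^'n^'n) \<Rightarrow> 'n \<Rightarrow> 'n \<Rightarrow> 'n \<Rightarrow> 'm \<Rightarrow> real" where
  "christoffel c G l i j p = 1/2 * (\<Sum>m\<in>UNIV. matrix_inv (G p) $ l $ m *
     (chart_partial c i (\<lambda>q. G q $ j $ m) p + chart_partial c j (\<lambda>q. G q $ i $ m) p
        - chart_partial c m (\<lambda>q. G q $ i $ j) p))"

text \<open>
  \<open>riem_up c G i j k l\<close> is the \<open>l\<close>-th component of
  \<open>\<nabla>\<^sub>i \<nabla>\<^sub>j \<partial>\<^sub>k - \<nabla>\<^sub>j \<nabla>\<^sub>i \<partial>\<^sub>k\<close>, and \<open>riem\<close> has this last index lowered.  The Ricci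
  tensor is the trace over \<open>i\<close> and \<open>l\<close>; with these signs the round sphere has positive
  Ricci curvature.
\<close>

definition riem_up ::
    "('m, 'n::finite) chart \<Rightarrow> ('m \<Rightarrow> real^'n^'n) \<Rightarrow> 'n \<Rightarrow> 'n \<Rightarrow> 'n \<Rightarrow> 'n \<Rightarrow> 'm \<Rightarrow> real" where
  "riem_up c G i j k l p =
     chart_partial c i (christoffel c G l j k) p - chart_partial c j (christoffel c G l i k) p
     + (\<Sum>m\<in>UNIV. christoffel c G m j k p * christoffel c G l i m p
                   - christoffel c G m i k p * christoffel c G l j m p)"

definition riem ::
    "('m, 'n::finite) chart \<Rightarrow> ('m \<Rightarrow> real^'n^'n) \<Rightarrow> 'n \<Rightarrow> 'n \<Rightarrow> 'n \<Rightarrow> 'n \<Rightarrow> 'm \<Rightarrow> real" where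
  "riem c G i j k l p = (\<Sum>m\<in>UNIV. riem_up c G i j k m p * G p $ m $ l)"

definition ricci :: "('m, 'n::finite) chart \<Rightarrow> ('m \<Rightarrow> real^'n^'n) \<Rightarrow> 'm \<Rightarrow> real^'n^'n" where
  "ricci c G p = (\<chi> j k. \<Sum>i\<in>UNIV. riem_up c G i j k i p)"

text \<open>The next three functions are independent of the chosen chart, being full contractions.\<close>

definition scalar_curv :: "('m, 'n::finite) chart set \<Rightarrow> ('m, 'n) tensor2 \<Rightarrow> 'm \<Rightarrow> real" where
  "scalar_curv A h p = (let c = chart_at A p; H = matrix_inv (h c p) in
     \<Sum>i\<in>UNIV. \<Sum>j\<in>UNIV. H $ i $ j * ricci c (h c) p $ i $ j)"

definition ricci_norm_sq :: "('m, 'n::finite) chart set \<Rightarrow> ('m, 'n) tensor2 \<Rightarrow> 'm \<Rightarrow> real" where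
  "ricci_norm_sq A h p = (let c = chart_at A p; H = matrix_inv (h c p) in
     \<Sum>i\<in>UNIV. \<Sum>j\<in>UNIV. \<Sum>i'\<in>UNIV. \<Sum>j'\<in>UNIV.
       H $ i $ i' * H $ j $ j' * ricci c (h c) p $ i $ j * ricci c (h c) p $ i' $ j')"

definition riem_norm_sq :: "('m, 'n::finite) chart set \<Rightarrow> ('m, 'n) tensor2 \<Rightarrow> 'm \<Rightarrow> real" where
  "riem_norm_sq A h p = (let c = chart_at A p; H = matrix_inv (h c p) in
     \<Sum>i\<in>UNIV. \<Sum>j\<in>UNIV. \<Sum>k\<in>UNIV. \<Sum>l\<in>UNIV.
     \<Sum>i'\<in>UNIV. \<Sum>j'\<in>UNIV. \<Sum>k'\<in>UNIV. \<Sum>l'\<in>UNIV.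
       H $ i $ i' * H $ j $ j' * H $ k $ k' * H $ l $ l' *
       riem c (h c) i j k l p * riem c (h c) i' j' k' l' p)"


section \<open>Ricci flow\<close>

definition ricci_flow ::
    "('m::topological_space, 'n::finite) chart set \<Rightarrow> real \<Rightarrow> (real \<Rightarrow> ('m, 'n) tensor2) \<Rightarrow> bool" where
  "ricci_flow A T g \<longleftrightarrow>
     (\<forall>t\<in>{0..<T}. riemannian_metric A (g t)) \<and>
     (\<forall>c\<in>A. smooth_on ({0..<T} \<times> chart_image c) (\<lambda>(t, x). g t c (chart_inv c x))) \<and>
     (\<forall>t\<in>{0..<T}. \<forall>c\<in>A. \<forall>p\<in>fst c.
        ((\<lambda>\<tau>. g \<tau> c p) has_vector_derivative (-2) *\<^sub>R ricci c (g t c) p) (at t within {0..<T}))"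

definition good_time ::
    "('m::topological_space, 'n::finite) chart set \<Rightarrow> real \<Rightarrow> (real \<Rightarrow> ('m, 'n) tensor2) \<Rightarrow> real \<Rightarrow> bool" where
  "good_time A T g t \<longleftrightarrow> t \<in> {0..<T} \<and>
     (\<integral>\<^sup>+q. ennreal ((ricci_norm_sq A (g t) q)\<^sup>2) \<partial>vol A (g t)) \<le> ennreal (1 / (T - t))"

definition riem_energy ::
    "('m::topological_space, 'n::finite) chart set \<Rightarrow> ('m, 'n) tensor2 \<Rightarrow> 'm \<Rightarrow> real \<Rightarrow> ennreal" where
  "riem_energy A h p r = (\<integral>\<^sup>+q\<in>rball A h p r. ennreal (riem_norm_sq A h q) \<partial>vol A h)"

definition Reg ::
    "('m::topological_space, 'n::finite) chart set \<Rightarrow> real \<Rightarrow> (real \<Rightarrow> ('m, 'n) tensor2) \<Rightarrow>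
     real \<Rightarrow> 'm set" where
  "Reg A T g \<epsilon> = {p. \<exists>r>0. \<forall>t\<in>{0..<T}. riem_energy A (g t) p r \<le> ennreal \<epsilon>}"

definition Reg_at ::
    "('m::topological_space, 'n::finite) chart set \<Rightarrow> real \<Rightarrow> (real \<Rightarrow> ('m, 'n) tensor2) \<Rightarrow>
     real \<Rightarrow> real \<Rightarrow> real \<Rightarrow> 'm set" where
  "Reg_at A T g R \<epsilon> t = {p. riem_energy A (g t) p (R * sqrt (T - t)) \<le> ennreal \<epsilon>}"

text \<open>The defining property of the fixed constants.  The sets \<open>Reg_at\<close> are only considered for \<open>0 < t < T\<close>.\<close>

definition regularity_constants ::
    "('m::topological_space, 'n::finite) chart set \<Rightarrow> real \<Rightarrow> (real \<Rightarrow> ('m, 'n) tensor2) \<Rightarrow>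
     real \<Rightarrow> real \<Rightarrow> real \<Rightarrow> bool" where
  "regularity_constants A T g R v \<epsilon> \<longleftrightarrow> R > 0 \<and> v > 0 \<and> \<epsilon> > 0 \<and>
     (\<forall>t\<in>{0<..<T}. \<forall>p. good_time A T g t \<and> \<bar>T - t\<bar> \<le> v \<and> p \<in> Reg_at A T g R \<epsilon> t \<longrightarrow>
        (let B = rball A (g t) p (R / 2 * sqrt (T - t)) in
           p \<in> Reg A T g \<epsilon> \<and> B \<subseteq> Reg A T g \<epsilon> \<and>
           (\<forall>q\<in>B. \<forall>r\<in>{t..<T}. \<forall>s\<in>{t..<T}.
              metric_le_at A q (1/2) (g r) 1 (g s) \<and> metric_le_at A q 1 (g s) 2 (g r) \<and>
              (let \<theta> = 8 * \<bar>(r - t) powr (1/4) - (s - t) powr (1/4)\<bar> / (T - t) powr (1/4) in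
                 metric_le_at A q (exp (- \<theta>)) (g r) 1 (g s) \<and>
                 metric_le_at A q 1 (g s) (exp \<theta>) (g r)))))"

end

theory Submission
  imports Defs
begin

text \<open>
  Write \<open>\<rho> = R/200 \<cdot> \<surd>(T - t)\<close>.  On the \<open>g(t)\<close>-ball of radius \<open>100\<rho>\<close> about \<open>p\<close> the metrics \<open>g(s)\<close>
  and \<open>g(t)\<close> agree up to a factor 2, hence so do squared lengths of curves inside it.  Two points
  of the \<open>\<rho>\<close>-ball have \<open>g(t)\<close>-distance less than \<open>2\<rho>\<close>.  An almost minimising \<open>g(t)\<close>-curve between
  them stays in the \<open>3\<rho>\<close>-ball, which bounds \<open>d(x,y,s)\<close> by \<open>\<surd>2 d(x,y,t)\<close>.  Conversely, a curve from
  \<open>x\<close> to \<open>y\<close> either has \<open>g(t)\<close>-length at most \<open>2\<rho>\<close> and stays in the \<open>3\<rho>\<close>-ball, or has an initial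
  piece there of \<open>g(t)\<close>-length \<open>2\<rho>\<close>; in both cases its \<open>g(s)\<close>-length is at least
  \<open>d(x,y,t) / \<surd>2\<close>.  Passing through time \<open>t\<close> compares any two times, even with the factor 2.
\<close>

section \<open>Piecewise \<open>C\<^sup>1\<close> curves and their lengths\<close>

lemma chart_at:
  assumes "smooth_atlas A"
  shows "chart_at A p \<in> A" "p \<in> fst (chart_at A p)"
proof -
  have "\<exists>c. c \<in> A \<and> p \<in> fst c"
    using assms unfolding smooth_atlas_def by (metis UNIV_I UN_E)
  then show "chart_at A p \<in> A" "p \<in> fst (chart_at A p)"
    unfolding chart_at_def by (metis (mono_tags, lifting) someI_ex)+
qed

lemma smooth_atlasD:
  assumes "smooth_atlas A" "c \<in> A"
  shows "open (fst c)" "open (chart_image c)"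
    "homeomorphism (fst c) (chart_image c) (snd c) (chart_inv c)"
  using assms unfolding smooth_atlas_def by blast+

text \<open>A chart is an open map onto its image, and the image is open in the model space.
  Openness of the overlap lets derivatives within it be read as ordinary derivatives.\<close>

lemma open_chart_overlap:
  assumes "smooth_atlas A" "c \<in> A" "c' \<in> A"
  shows "open (snd c ` (fst c \<inter> fst c'))"
proof -
  have "openin (top_of_set (fst c)) (fst c \<inter> fst c')"
    using smooth_atlasD(1)[OF assms(1,3)] by (simp add: openin_open_Int)
  then have "openin (top_of_set (chart_image c)) (snd c ` (fst c \<inter> fst c'))"
    using homeomorphism_imp_open_map smooth_atlasD(3)[OF assms(1,2)] by blast
  then show ?thesis
    using smooth_atlasD(2)[OF assms(1,2)] openin_open_eq by blast
qed

text \<open>This is the case \<open>k = 1\<close> of smoothness. It controls only the partial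
  derivatives along \<open>Basis\<close>; continuity in an arbitrary direction \<open>v\<close>
  follows by expanding \<open>v\<close> in the basis and using linearity.\<close>

lemma transition_C1:
  assumes "smooth_atlas A" "c \<in> A" "c' \<in> A"
  defines "U \<equiv> snd c ` (fst c \<inter> fst c')" and "\<tau> \<equiv> snd c' \<circ> chart_inv c"
  shows "x \<in> U \<Longrightarrow> (\<tau> has_derivative frechet_derivative \<tau> (at x)) (at x)"
    and "continuous_on U (\<lambda>x. frechet_derivative \<tau> (at x) v)"
proof -
  have U: "open U"
    unfolding U_def by (rule open_chart_overlap[OF assms(1-3)])
  have "smooth_on U \<tau>"
    using assms(1-3) unfolding U_def \<tau>_def smooth_atlas_def by blast
  then have C1: "Ck_on (Suc 0) U \<tau>"
    unfolding smooth_on_def by blast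
  show der: "(\<tau> has_derivative frechet_derivative \<tau> (at x)) (at x)" if "x \<in> U" for x
    using C1 that U by (simp add: differentiable_on_eq_differentiable_at frechet_derivative_works[symmetric])
  have "continuous_on U (\<lambda>x. frechet_derivative \<tau> (at x) i)" if "i \<in> Basis" for i
  proof -
    have "continuous_on U (\<lambda>x. frechet_derivative \<tau> (at x within U) i)"
      using C1 that by simp
    then show ?thesis
      by (rule continuous_on_eq) (simp add: at_within_open[OF _ U])
  qed
  then have "continuous_on U (\<lambda>x. \<Sum>i\<in>Basis. (v \<bullet> i) *\<^sub>R frechet_derivative \<tau> (at x) i)"
    by (intro continuous_intros) auto
  then show "continuous_on U (\<lambda>x. frechet_derivative \<tau> (at x) v)"
  proof (rule continuous_on_eq)
    fix x assume "x \<in> U"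
    have "linear (frechet_derivative \<tau> (at x))"
      using der[OF \<open>x \<in> U\<close>] has_derivative_linear by blast
    then have "(\<Sum>i\<in>Basis. (v \<bullet> i) *\<^sub>R frechet_derivative \<tau> (at x) i)
        = frechet_derivative \<tau> (at x) (\<Sum>i\<in>Basis. (v \<bullet> i) *\<^sub>R i)"
      by (simp add: linear_cmul linear_sum)
    then show "(\<Sum>i\<in>Basis. (v \<bullet> i) *\<^sub>R frechet_derivative \<tau> (at x) i)
        = frechet_derivative \<tau> (at x) v"
      by (simp only: euclidean_representation)
  qed
qed

section \<open>Speed of a curve\<close>

text \<open>The chain rule turns the velocity \<open>w\<close> in the chart \<open>c\<close> into
  \<open>J *v w\<close> in the chart selected by \<open>chart_at\<close>, and the transformation law
  of \<open>h\<close> absorbs the two factors \<open>J\<close>.\<close>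

lemma speed_eq:
  assumes A: "smooth_atlas A" and h: "riemannian_metric A h"
    and c: "c \<in> A" "\<gamma> s \<in> fst c" and cont: "isCont \<gamma> s"
    and der: "((snd c \<circ> \<gamma>) has_vector_derivative w) (at s)"
  shows "speed A h \<gamma> s = sqrt (w \<bullet> (h c (\<gamma> s) *v w))"
proof -
  define c' where "c' = chart_at A (\<gamma> s)"
  have c': "c' \<in> A" "\<gamma> s \<in> fst c'"
    using chart_at[OF A] by (auto simp: c'_def)
  define \<tau> where "\<tau> = snd c' \<circ> chart_inv c"
  define J where "J = jacobian \<tau> (at (snd c (\<gamma> s)))"
  have "(\<tau> has_derivative frechet_derivative \<tau> (at (snd c (\<gamma> s)))) (at (snd c (\<gamma> s)))"
    unfolding \<tau>_def using transition_C1(1)[OF A c(1) c'(1)] c c' by blast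
  then have dtau: "(\<tau> has_derivative (\<lambda>v. J *v v)) (at (snd c (\<gamma> s)))"
    unfolding J_def using differentiableI jacobian_works by blast
  have "((\<tau> \<circ> (snd c \<circ> \<gamma>)) has_vector_derivative J *v w) (at s)"
    using vector_derivative_diff_chain_within[OF der, of \<tau> "\<lambda>v. J *v v"] dtau
    by (simp add: has_derivative_at_withinI)
  \<comment> \<open>Chart values outside the domain are arbitrary, so the two coordinate expressions
    of the curve can be identified only where the curve lies in \<open>fst c\<close>. Continuity at
    \<open>s\<close> makes this a neighbourhood of \<open>s\<close>.\<close>
  moreover have "eventually (\<lambda>u. \<gamma> u \<in> fst c) (nhds s)"
    using cont c smooth_atlasD(1)[OF A c(1)]
    by (metis continuous_within eventually_nhds_conv_at tendsto_def)
  then obtain N where N: "open N" "s \<in> N" "\<And>u. u \<in> N \<Longrightarrow> \<gamma> u \<in> fst c"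
    unfolding eventually_nhds by blast
  have "(\<tau> \<circ> (snd c \<circ> \<gamma>)) u = (snd c' \<circ> \<gamma>) u" if "u \<in> N" for u
    using N(3)[OF that] smooth_atlasD(3)[OF A c(1)] by (simp add: \<tau>_def homeomorphism_def)
  ultimately have "((snd c' \<circ> \<gamma>) has_vector_derivative J *v w) (at s)"
    using has_vector_derivative_transform_within_open N by blast
  then have vd: "vector_derivative (snd c' \<circ> \<gamma>) (at s) = J *v w"
    by (rule vector_derivative_at)
  have "h c (\<gamma> s) = transpose J ** h c' (\<gamma> s) ** J"
    using h c c' unfolding riemannian_metric_def J_def \<tau>_def Let_def by blast
  then have "w \<bullet> (h c (\<gamma> s) *v w) = w \<bullet> (transpose J *v (h c' (\<gamma> s) *v (J *v w)))"
    by (simp only: matrix_vector_mul_assoc matrix_mul_assoc)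
  also have "\<dots> = (J *v w) \<bullet> (h c' (\<gamma> s) *v (J *v w))"
    by (metis dot_lmul_matrix inner_commute transpose_matrix_vector)
  finally show ?thesis
    unfolding speed_def Let_def c'_def[symmetric] vd by simp
qed

lemma speed_nonneg:
  assumes "smooth_atlas A" "riemannian_metric A h"
  shows "0 \<le> speed A h \<gamma> s"
proof -
  have "0 \<le> w \<bullet> (h (chart_at A p) p *v w)" for w p
    using assms(2) chart_at[OF assms(1), of p] unfolding riemannian_metric_def
    by (cases "w = 0") (auto intro: less_imp_le)
  then show ?thesis
    unfolding speed_def Let_def by simp
qed

text \<open>Both speeds use the same chart and the same vector, whatever
  \<open>vector_derivative\<close> returns at a break point. The comparison therefore holds at every
  parameter, break points included.\<close>

lemma speed_le:
  assumes "smooth_atlas A" "metric_le_at A (\<gamma> s) a h b k"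
  shows "sqrt a * speed A h \<gamma> s \<le> sqrt b * speed A k \<gamma> s"
proof -
  have "form_le (a *\<^sub>R h (chart_at A (\<gamma> s)) (\<gamma> s)) (b *\<^sub>R k (chart_at A (\<gamma> s)) (\<gamma> s))"
    using assms(2) chart_at[OF assms(1)] unfolding metric_le_at_def by blast
  then show ?thesis
    unfolding form_le_def speed_def Let_def real_sqrt_mult[symmetric]
    by (simp add: scaleR_matrix_vector_assoc[symmetric])
qed

section \<open>Curves of class C1 and integrability of their speed\<close>

lemma C1_curve_iff:
  "C1_curve A \<gamma> a b \<longleftrightarrow> continuous_on {a..b} \<gamma> \<and>
     (\<forall>c\<in>A. \<exists>D. continuous_on {s\<in>{a..b}. \<gamma> s \<in> fst c} D \<and>
       (\<forall>s\<in>{s\<in>{a..b}. \<gamma> s \<in> fst c}.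
         ((snd c \<circ> \<gamma>) has_vector_derivative D s) (at s within {s\<in>{a..b}. \<gamma> s \<in> fst c})))"
  unfolding C1_curve_def Let_def ..

lemma C1_curve_chartE:
  assumes "C1_curve A \<gamma> a b" "c \<in> A" and S: "S = {s\<in>{a..b}. \<gamma> s \<in> fst c}"
  obtains D where "continuous_on S D"
    and "\<And>s. s \<in> S \<Longrightarrow> ((snd c \<circ> \<gamma>) has_vector_derivative D s) (at s within S)"
  using assms(1,2) unfolding C1_curve_iff S by blast

text \<open>\<open>C1_curve\<close> differentiates within the set of times at which the curve is in
  the chart. Around an interior time this set is a neighbourhood, so the derivative there is the
  two-sided one that \<open>speed\<close> refers to.\<close>

lemma C1_curve_derivative:
  assumes A: "smooth_atlas A" and \<gamma>: "C1_curve A \<gamma> a b" and c: "c \<in> A"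
  obtains D where "continuous_on {s\<in>{a..b}. \<gamma> s \<in> fst c} D"
    and "\<And>s. s \<in> {a<..<b} \<Longrightarrow> \<gamma> s \<in> fst c \<Longrightarrow> ((snd c \<circ> \<gamma>) has_vector_derivative D s) (at s)"
proof -
  define S where "S = {s\<in>{a..b}. \<gamma> s \<in> fst c}"
  obtain D where D: "continuous_on S D"
      "\<And>s. s \<in> S \<Longrightarrow> ((snd c \<circ> \<gamma>) has_vector_derivative D s) (at s within S)"
    using C1_curve_chartE[OF \<gamma> c S_def] by blast
  have "((snd c \<circ> \<gamma>) has_vector_derivative D s) (at s)" if s: "s \<in> {a<..<b}" "\<gamma> s \<in> fst c" for s
  proof -
    have "continuous_on {a<..<b} \<gamma>"
      using \<gamma> unfolding C1_curve_def by (auto elim: continuous_on_subset)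
    then have "open ({a<..<b} \<inter> \<gamma> -` fst c)"
      by (rule continuous_open_preimage) (simp_all add: smooth_atlasD(1)[OF A c])
    moreover have "{a<..<b} \<inter> \<gamma> -` fst c \<subseteq> S" "s \<in> {a<..<b} \<inter> \<gamma> -` fst c"
      using s unfolding S_def by auto
    ultimately have "at s within S = at s"
      by (intro at_within_open_subset[of s "{a<..<b} \<inter> \<gamma> -` fst c" S])
    moreover have "s \<in> S"
      using s by (simp add: S_def)
    ultimately show ?thesis
      using D(2)[of s] by metis
  qed
  then show ?thesis
    using D(1) that unfolding S_def by blast
qed

lemma C1_curve_isCont:
  assumes "C1_curve A \<gamma> a b" "s \<in> {a<..<b}"
  shows "isCont \<gamma> s"
  using assms continuous_on_interior[of "{a..b}" \<gamma> s] unfolding C1_curve_def by simp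

lemma C1_curve_subinterval:
  assumes "C1_curve A \<gamma> a b" "{u..w} \<subseteq> {a..b}"
  shows "C1_curve A \<gamma> u w"
proof -
  have "\<exists>D. continuous_on {s\<in>{u..w}. \<gamma> s \<in> fst c} D \<and>
      (\<forall>s\<in>{s\<in>{u..w}. \<gamma> s \<in> fst c}.
        ((snd c \<circ> \<gamma>) has_vector_derivative D s) (at s within {s\<in>{u..w}. \<gamma> s \<in> fst c}))"
    if c: "c \<in> A" for c
  proof -
    have sub: "{s\<in>{u..w}. \<gamma> s \<in> fst c} \<subseteq> {s\<in>{a..b}. \<gamma> s \<in> fst c}"
      using assms(2) by auto
    obtain D where "continuous_on {s\<in>{a..b}. \<gamma> s \<in> fst c} D"
      "\<forall>s\<in>{s\<in>{a..b}. \<gamma> s \<in> fst c}.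
        ((snd c \<circ> \<gamma>) has_vector_derivative D s) (at s within {s\<in>{a..b}. \<gamma> s \<in> fst c})"
      using assms(1) c unfolding C1_curve_iff by blast
    then show ?thesis
      using sub continuous_on_subset[OF _ sub] has_vector_derivative_within_subset[OF _ sub] by blast
  qed
  moreover have "continuous_on {u..w} \<gamma>"
    using assms continuous_on_subset unfolding C1_curve_def by blast
  ultimately show ?thesis
    unfolding C1_curve_iff by blast
qed

lemma C1_curve_cong:
  assumes eq: "\<And>s. s \<in> {a..b} \<Longrightarrow> \<gamma> s = \<sigma> s" and "C1_curve A \<gamma> a b"
  shows "C1_curve A \<sigma> a b"
proof -
  have "\<exists>D. continuous_on {s\<in>{a..b}. \<sigma> s \<in> fst c} D \<and>
      (\<forall>s\<in>{s\<in>{a..b}. \<sigma> s \<in> fst c}.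
        ((snd c \<circ> \<sigma>) has_vector_derivative D s) (at s within {s\<in>{a..b}. \<sigma> s \<in> fst c}))"
    if c: "c \<in> A" for c
  proof -
    define S where "S = {s\<in>{a..b}. \<gamma> s \<in> fst c}"
    have S: "{s\<in>{a..b}. \<sigma> s \<in> fst c} = S"
      using eq by (auto simp: S_def)
    obtain D where D: "continuous_on S D"
        "\<And>s. s \<in> S \<Longrightarrow> ((snd c \<circ> \<gamma>) has_vector_derivative D s) (at s within S)"
      using C1_curve_chartE[OF assms(2) c S_def] by blast
    have "((snd c \<circ> \<sigma>) has_vector_derivative D s) (at s within S)" if "s \<in> S" for s
    proof (rule has_vector_derivative_transform[OF that _ D(2)[OF that]])
      show "(snd c \<circ> \<sigma>) u = (snd c \<circ> \<gamma>) u" if "u \<in> S" for u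
        using that eq by (simp add: S_def)
    qed
    then show ?thesis
      unfolding S using D(1) by blast
  qed
  moreover have "continuous_on {a..b} \<sigma>"
    using assms(2) eq continuous_on_eq unfolding C1_curve_iff by blast
  ultimately show ?thesis
    unfolding C1_curve_iff by blast
qed

text \<open>Near each time the curve stays in one chart, where the speed is given by a continuous
  function up to the endpoints. Local integrability then extends to the whole compact
  interval.\<close>

lemma C1_curve_speed_integrable:
  assumes A: "smooth_atlas A" and h: "riemannian_metric A h" and \<gamma>: "C1_curve A \<gamma> a b"
  shows "speed A h \<gamma> integrable_on {a..b}"
proof -
  have "\<exists>d>0. \<forall>u v. x \<in> cbox u v \<and> cbox u v \<subseteq> ball x d \<and> cbox u v \<subseteq> cbox a b \<longrightarrow>
      speed A h \<gamma> integrable_on cbox u v" if x: "x \<in> cbox a b" for x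
  proof -
    define c where "c = chart_at A (\<gamma> x)"
    have c: "c \<in> A" "\<gamma> x \<in> fst c"
      using chart_at[OF A] by (auto simp: c_def)
    define S where "S = {s\<in>{a..b}. \<gamma> s \<in> fst c}"
    obtain D where D: "continuous_on S D"
      "\<And>s. s \<in> {a<..<b} \<Longrightarrow> \<gamma> s \<in> fst c \<Longrightarrow> ((snd c \<circ> \<gamma>) has_vector_derivative D s) (at s)"
      using C1_curve_derivative[OF A \<gamma> c(1)] unfolding S_def by blast
    have cg: "continuous_on {a..b} \<gamma>"
      using \<gamma> unfolding C1_curve_def by simp
    then obtain N where N: "open N" "x \<in> N" "\<And>s. s \<in> {a..b} \<inter> N \<Longrightarrow> \<gamma> s \<in> fst c"
      using x c smooth_atlasD(1)[OF A c(1)] unfolding continuous_on_topological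
      by (metis IntE box_real(2))
    then obtain d where d: "d > 0" "ball x d \<subseteq> N"
      using open_contains_ball by blast
    define F where "F s = sqrt (D s \<bullet> (h c (\<gamma> s) *v D s))" for s
    have "continuous_on (chart_image c) (\<lambda>x. h c (chart_inv c x))"
      using h c(1) unfolding riemannian_metric_def smooth_on_def by (metis Ck_on.simps(1))
    moreover have "continuous_on S (snd c \<circ> \<gamma>)"
      using smooth_atlasD(3)[OF A c(1)] cg unfolding S_def homeomorphism_def
      by (intro continuous_on_compose) (auto elim: continuous_on_subset)
    ultimately have "continuous_on S (\<lambda>s. h c (chart_inv c ((snd c \<circ> \<gamma>) s)))"
      by (rule continuous_on_compose2) (auto simp: S_def)
    moreover have "h c (chart_inv c ((snd c \<circ> \<gamma>) s)) = h c (\<gamma> s)" if "s \<in> S" for s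
      using that smooth_atlasD(3)[OF A c(1)] unfolding S_def homeomorphism_def by auto
    ultimately have "continuous_on S (\<lambda>s. h c (\<gamma> s))"
      by (rule continuous_on_eq)
    then have F: "continuous_on S F"
      unfolding F_def matrix_vector_mult_def inner_vec_def using D(1)
      by (auto intro!: continuous_intros)
    show ?thesis
    proof (intro exI[of _ d] conjI allI impI d(1))
      fix u v
      assume uv: "x \<in> cbox u v \<and> cbox u v \<subseteq> ball x d \<and> cbox u v \<subseteq> cbox a b"
      then have sub: "cbox u v \<subseteq> S"
        using d N(3) unfolding S_def by auto
      have "F integrable_on cbox u v"
        using F sub continuous_on_subset integrable_continuous by blast
      \<comment> \<open>At \<open>a\<close> and \<open>b\<close> the two-sided derivative in
        \<open>speed\<close> also depends on the curve outside the interval, so these two points are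
        left out.\<close>
      moreover have "speed A h \<gamma> s = F s" if "s \<in> cbox u v - {a, b}" for s
      proof -
        have s: "s \<in> {a<..<b}" "\<gamma> s \<in> fst c"
          using that sub unfolding S_def by auto
        show ?thesis
          unfolding F_def
          using speed_eq[OF A h c(1) s(2) C1_curve_isCont[OF \<gamma> s(1)] D(2)[OF s]] .
      qed
      ultimately show "speed A h \<gamma> integrable_on cbox u v"
        using integrable_spike_finite[of "{a, b}"] by (metis finite.emptyI finite.insertI)
    qed
  qed
  then have "speed A h \<gamma> integrable_on cbox a b"
    using integrable_on_little_subintervals by blast
  then show ?thesis by simp
qed

section \<open>Piecewise C1 curves and their break points\<close>

text \<open>Here \<open>P\<close> is an arbitrary finite set, and every interval whose interior
  avoids it must be a C1 piece, not only those between consecutive break points. This form behaves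
  well under restriction, preimages and unions of break point sets.\<close>

lemma piecewise_C1_curve_iff:
  assumes "a < b"
  shows "piecewise_C1_curve A \<gamma> a b \<longleftrightarrow> continuous_on {a..b} \<gamma> \<and>
    (\<exists>P. finite P \<and> (\<forall>u w. a \<le> u \<and> u < w \<and> w \<le> b \<and> {u<..<w} \<inter> P = {} \<longrightarrow> C1_curve A \<gamma> u w))"
    (is "_ \<longleftrightarrow> _ \<and> (\<exists>P. finite P \<and> ?C1 P)")
proof -
  have "\<exists>P. finite P \<and> ?C1 P"
    if P: "finite P" "{a, b} \<subseteq> P" "P \<subseteq> {a..b}"
      "\<forall>u\<in>P. \<forall>w\<in>P. u < w \<and> {u<..<w} \<inter> P = {} \<longrightarrow> C1_curve A \<gamma> u w" for P
  proof (intro exI[of _ P] conjI P(1) allI impI)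
    fix u w
    assume uw: "a \<le> u \<and> u < w \<and> w \<le> b \<and> {u<..<w} \<inter> P = {}"
    \<comment> \<open>\<open>u'\<close> and \<open>w'\<close> are the nearest break points on either
      side of \<open>[u, w]\<close>; they exist because \<open>a\<close> and \<open>b\<close> are
      break points.\<close>
    define u' where "u' = Max (P \<inter> {..u})"
    define w' where "w' = Min (P \<inter> {w..})"
    have ne: "P \<inter> {..u} \<noteq> {}" "P \<inter> {w..} \<noteq> {}"
      using P(2) uw by auto
    have u': "u' \<in> P" "u' \<le> u"
      using Max_in[OF _ ne(1)] P(1) unfolding u'_def by auto
    have w': "w' \<in> P" "w \<le> w'"
      using Min_in[OF _ ne(2)] P(1) unfolding w'_def by auto
    have "x \<notin> P" if "u' < x" "x < w'" for x
    proof
      assume x: "x \<in> P"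
      then have "\<not> x \<le> u"
        using that(1) P(1) x Max_ge[of "P \<inter> {..u}" x] unfolding u'_def by fastforce
      moreover have "\<not> w \<le> x"
        using that(2) P(1) x Min_le[of "P \<inter> {w..}" x] unfolding w'_def by fastforce
      ultimately show False
        using x uw by (auto simp: disjoint_iff)
    qed
    then have "{u'<..<w'} \<inter> P = {}"
      by auto
    then have "C1_curve A \<gamma> u' w'"
      using P(4) u' w' uw by auto
    then show "C1_curve A \<gamma> u w"
      by (rule C1_curve_subinterval) (use u' w' in auto)
  qed
  \<comment> \<open>\<open>P\<close> may miss the endpoints and contain points outside
    \<open>[a, b]\<close>, hence the intersection and the two insertions in the witness.\<close>
  moreover have "\<exists>Q. finite Q \<and> {a, b} \<subseteq> Q \<and> Q \<subseteq> {a..b} \<and>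
      (\<forall>u\<in>Q. \<forall>w\<in>Q. u < w \<and> {u<..<w} \<inter> Q = {} \<longrightarrow> C1_curve A \<gamma> u w)"
    if P: "finite P" "?C1 P" for P
  proof (intro exI[of _ "insert a (insert b (P \<inter> {a..b}))"] conjI ballI impI)
    fix u w
    assume uw: "u \<in> insert a (insert b (P \<inter> {a..b}))" "w \<in> insert a (insert b (P \<inter> {a..b}))"
      "u < w \<and> {u<..<w} \<inter> insert a (insert b (P \<inter> {a..b})) = {}"
    have "a \<le> u" "w \<le> b"
      using uw(1,2) assms by auto
    moreover from this have "{u<..<w} \<inter> P = {}"
      using uw(3) by auto
    ultimately show "C1_curve A \<gamma> u w"
      using P(2) uw(3) by blast
  qed (use P(1) assms in auto)
  ultimately show ?thesis
    unfolding piecewise_C1_curve_def by (intro conj_cong iffI refl; elim exE conjE) simp_all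
qed

lemma piecewise_C1_curve_subinterval:
  assumes "piecewise_C1_curve A \<gamma> a b" "a \<le> u" "u < w" "w \<le> b"
  shows "piecewise_C1_curve A \<gamma> u w"
proof -
  have "a < b" using assms by simp
  obtain P where "continuous_on {a..b} \<gamma>" "finite P"
    and P: "\<And>u w. a \<le> u \<and> u < w \<and> w \<le> b \<and> {u<..<w} \<inter> P = {} \<Longrightarrow> C1_curve A \<gamma> u w"
    using assms(1) unfolding piecewise_C1_curve_iff[OF \<open>a < b\<close>] by blast
  moreover have "C1_curve A \<gamma> x y" if "u \<le> x \<and> x < y \<and> y \<le> w \<and> {x<..<y} \<inter> P = {}" for x y
    using P[of x y] that assms by simp
  ultimately show ?thesis
    unfolding piecewise_C1_curve_iff[OF assms(3)] using assms
      continuous_on_subset[of "{a..b}" \<gamma> "{u..w}"] by auto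
qed

lemma piecewise_C1_curve_differentiable:
  assumes A: "smooth_atlas A" and "a < b" "piecewise_C1_curve A \<gamma> a b"
  obtains P where "finite P"
    and "\<And>s c. s \<in> {a..b} - P \<Longrightarrow> c \<in> A \<Longrightarrow> \<gamma> s \<in> fst c \<Longrightarrow>
      \<exists>w. ((snd c \<circ> \<gamma>) has_vector_derivative w) (at s)"
proof -
  obtain P where P: "finite P"
      "\<And>u w. a \<le> u \<and> u < w \<and> w \<le> b \<and> {u<..<w} \<inter> P = {} \<Longrightarrow> C1_curve A \<gamma> u w"
    using assms(3) unfolding piecewise_C1_curve_iff[OF assms(2)] by blast
  have "\<exists>w. ((snd c \<circ> \<gamma>) has_vector_derivative w) (at s)"
    if s: "s \<in> {a..b} - (insert a (insert b P))" and c: "c \<in> A" "\<gamma> s \<in> fst c" for s c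
  proof -
    \<comment> \<open>A small closed interval around \<open>s\<close> avoids all break points, so it
      is a C1 piece with \<open>s\<close> in its interior.\<close>
    have "open ({a<..<b} - P)" "s \<in> {a<..<b} - P"
      using P(1) s by (auto simp: finite_imp_closed intro!: open_Diff)
    then obtain d where d: "d > 0" "cball s d \<subseteq> {a<..<b} - P"
      using open_contains_cball by metis
    then have sub: "{s - d..s + d} \<subseteq> {a<..<b} - P"
      by (simp add: cball_eq_atLeastAtMost)
    moreover have "s - d \<in> {s - d..s + d}" "s + d \<in> {s - d..s + d}"
      using d(1) by auto
    ultimately have "s - d \<in> {a<..<b}" "s + d \<in> {a<..<b}"
      by blast+
    moreover have "{s - d<..<s + d} \<inter> P = {}"
      using sub greaterThanLessThan_subseteq_atLeastAtMost_iff[of "s - d" "s + d" "s - d" "s + d"] by blast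
    ultimately have "C1_curve A \<gamma> (s - d) (s + d)"
      using P(2)[of "s - d" "s + d"] d(1) by simp
    then obtain D where "\<And>u. u \<in> {s - d<..<s + d} \<Longrightarrow> \<gamma> u \<in> fst c \<Longrightarrow>
        ((snd c \<circ> \<gamma>) has_vector_derivative D u) (at u)"
      using C1_curve_derivative[OF A _ c(1)] by blast
    then show ?thesis
      using c(2) d(1) by (intro exI[of _ "D s"]) simp
  qed
  then show ?thesis
    using that[of "insert a (insert b P)"] P(1) by blast
qed

text \<open>In a small interval around \<open>x\<close> only \<open>x\<close> itself can be a break
  point, so cutting the interval at \<open>x\<close> leaves two pieces covered by the C1
  case.\<close>

lemma piecewise_C1_curve_speed_integrable:
  assumes A: "smooth_atlas A" and h: "riemannian_metric A h"
    and ab: "a < b" and \<gamma>: "piecewise_C1_curve A \<gamma> a b"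
  shows "speed A h \<gamma> integrable_on {a..b}"
proof -
  obtain P where P: "finite P"
      "\<And>u w. a \<le> u \<and> u < w \<and> w \<le> b \<and> {u<..<w} \<inter> P = {} \<Longrightarrow> C1_curve A \<gamma> u w"
    using \<gamma> unfolding piecewise_C1_curve_iff[OF ab] by blast
  have int: "speed A h \<gamma> integrable_on {u..w}"
    if "a \<le> u" "w \<le> b" "{u<..<w} \<inter> P = {}" for u w
  proof (cases "u < w")
    case True
    then show ?thesis using C1_curve_speed_integrable[OF A h] P(2)[of u w] that by blast
  next
    \<comment> \<open>Degenerate intervals arise below when \<open>x\<close> is an endpoint of
      \<open>[u, v]\<close>.\<close>
    case False
    then show ?thesis using integrable_on_refl[of _ u] by (cases "u = w") auto
  qed
  have "\<exists>d>0. \<forall>u v. x \<in> cbox u v \<and> cbox u v \<subseteq> ball x d \<and> cbox u v \<subseteq> cbox a b \<longrightarrow>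
      speed A h \<gamma> integrable_on cbox u v" for x
  proof -
    obtain d where d: "d > 0" "\<And>y. y \<in> P \<Longrightarrow> y \<noteq> x \<Longrightarrow> d \<le> dist x y"
      using finite_set_avoid[OF P(1), of x] by blast
    show ?thesis
    proof (intro exI[of _ d] conjI allI impI d(1))
      fix u v
      assume uv: "x \<in> cbox u v \<and> cbox u v \<subseteq> ball x d \<and> cbox u v \<subseteq> cbox a b"
      then have x: "u \<le> x" "x \<le> v" and ends: "a \<le> u" "v \<le> b" and sub: "{u..v} \<subseteq> ball x d"
        by auto
      have "y \<notin> P" if "y \<in> {u..v}" "y \<noteq> x" for y
        using d(2)[of y] that sub by (auto simp: subset_iff)
      then have "{u<..<x} \<inter> P = {}" "{x<..<v} \<inter> P = {}"
        using x by auto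
      then have "speed A h \<gamma> integrable_on {u..x}" "speed A h \<gamma> integrable_on {x..v}"
        using int x ends by auto
      then show "speed A h \<gamma> integrable_on cbox u v"
        using Henstock_Kurzweil_Integration.integrable_combine[OF x] by simp
    qed
  qed
  then have "speed A h \<gamma> integrable_on cbox a b"
    using integrable_on_little_subintervals by blast
  then show ?thesis by simp
qed


section \<open>Reparametrisation and concatenation\<close>

text \<open>The slope is general so that one chain rule argument covers both later uses:
  \<open>m = 1\<close> shifts a curve before concatenation, and \<open>m = - 1\<close> reverses
  it.\<close>

lemma C1_curve_affine:
  assumes \<gamma>: "C1_curve A \<gamma> a b" and sub: "(\<lambda>s. m * s + k) ` {u..w} \<subseteq> {a..b}"
  shows "C1_curve A (\<lambda>s. \<gamma> (m * s + k)) u w"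
proof -
  define \<phi> where "\<phi> = (\<lambda>s. m * s + k)"
  have cphi: "continuous_on X \<phi>" for X
    unfolding \<phi>_def by (intro continuous_intros)
  have "\<exists>D'. continuous_on {s\<in>{u..w}. \<gamma> (\<phi> s) \<in> fst c} D' \<and>
      (\<forall>s\<in>{s\<in>{u..w}. \<gamma> (\<phi> s) \<in> fst c}. ((snd c \<circ> (\<lambda>s. \<gamma> (\<phi> s))) has_vector_derivative D' s)
        (at s within {s\<in>{u..w}. \<gamma> (\<phi> s) \<in> fst c}))" if c: "c \<in> A" for c
  proof -
    define S where "S = {s\<in>{a..b}. \<gamma> s \<in> fst c}"
    define S' where "S' = {s\<in>{u..w}. \<gamma> (\<phi> s) \<in> fst c}"
    obtain D where D: "continuous_on S D"
        "\<And>s. s \<in> S \<Longrightarrow> ((snd c \<circ> \<gamma>) has_vector_derivative D s) (at s within S)"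
      using C1_curve_chartE[OF \<gamma> c S_def] by blast
    have S': "\<phi> ` S' \<subseteq> S"
      using sub unfolding S_def S'_def \<phi>_def image_subset_iff by blast
    have "continuous_on S' (\<lambda>s. m *\<^sub>R D (\<phi> s))"
      by (intro continuous_intros continuous_on_compose2[OF D(1) cphi S'])
    moreover have "((snd c \<circ> (\<lambda>s. \<gamma> (\<phi> s))) has_vector_derivative m *\<^sub>R D (\<phi> s)) (at s within S')"
      if s: "s \<in> S'" for s
    proof -
      have "(\<phi> has_vector_derivative m) (at s within S')"
        unfolding \<phi>_def by (auto intro!: derivative_eq_intros)
      moreover have "((snd c \<circ> \<gamma>) has_vector_derivative D (\<phi> s)) (at (\<phi> s) within \<phi> ` S')"
        by (rule has_vector_derivative_within_subset[OF D(2) S']) (use S' s in blast)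
      ultimately show ?thesis
        using vector_diff_chain_within[of \<phi> m s S' "snd c \<circ> \<gamma>" "D (\<phi> s)"] by (simp add: o_def)
    qed
    ultimately show ?thesis
      unfolding S'_def by blast
  qed
  moreover have "continuous_on {u..w} (\<lambda>s. \<gamma> (\<phi> s))"
    using continuous_on_compose2[of "{a..b}" \<gamma> "{u..w}" \<phi>] cphi \<gamma> sub
    unfolding C1_curve_iff \<phi>_def by blast
  ultimately show ?thesis
    unfolding C1_curve_iff \<phi>_def by blast
qed

text \<open>The break points are pulled back along the affine map. A negative slope exchanges the
  endpoints of each piece, hence the case distinction.\<close>

lemma piecewise_C1_curve_affine:
  assumes m: "m \<noteq> 0" and "a < b" "u < w" and \<gamma>: "piecewise_C1_curve A \<gamma> a b"
    and sub: "(\<lambda>s. m * s + k) ` {u..w} \<subseteq> {a..b}"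
  shows "piecewise_C1_curve A (\<lambda>s. \<gamma> (m * s + k)) u w"
proof -
  obtain P where P: "continuous_on {a..b} \<gamma>" "finite P"
      "\<And>u w. a \<le> u \<and> u < w \<and> w \<le> b \<and> {u<..<w} \<inter> P = {} \<Longrightarrow> C1_curve A \<gamma> u w"
    using \<gamma> unfolding piecewise_C1_curve_iff[OF \<open>a < b\<close>] by blast
  define Q where "Q = (\<lambda>s. m * s + k) -` P"
  have Q: "finite Q"
    unfolding Q_def by (rule finite_vimageI[OF P(2)]) (use m in \<open>simp add: inj_def\<close>)
  have "C1_curve A (\<lambda>s. \<gamma> (m * s + k)) x y"
    if xy: "u \<le> x" "x < y" "y \<le> w" "{x<..<y} \<inter> Q = {}" for x y
  proof -
    have ends: "m * x + k \<in> {a..b}" "m * y + k \<in> {a..b}"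
      using sub xy unfolding image_subset_iff by simp_all
    have noP: "z \<notin> P" if "(z - k) / m \<in> {x<..<y}" for z
      using xy(4) that m unfolding Q_def by (auto simp: disjoint_iff)
    show ?thesis
    proof (cases "m > 0")
      case True
      then have "{m * x + k<..<m * y + k} \<inter> P = {}"
        using noP by (auto simp: disjoint_iff field_simps)
      then have "C1_curve A \<gamma> (m * x + k) (m * y + k)"
        using P(3)[of "m * x + k" "m * y + k"] ends xy True by simp
      then show ?thesis
        by (rule C1_curve_affine) (use True in auto)
    next
      case False
      then have m: "m < 0" using m by simp
      then have "{m * y + k<..<m * x + k} \<inter> P = {}"
        using noP by (auto simp: disjoint_iff field_simps)
      then have "C1_curve A \<gamma> (m * y + k) (m * x + k)"
        using P(3)[of "m * y + k" "m * x + k"] ends xy m by simp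
      then show ?thesis
        by (rule C1_curve_affine) (use m in \<open>auto simp: mult_left_mono_neg\<close>)
    qed
  qed
  moreover have "continuous_on {u..w} (\<lambda>s. \<gamma> (m * s + k))"
    by (rule continuous_on_compose2[OF P(1) _ sub]) (intro continuous_intros)
  ultimately show ?thesis
    unfolding piecewise_C1_curve_iff[OF \<open>u < w\<close>] using Q by blast
qed

text \<open>The velocity is multiplied by \<open>m\<close>, so the speed is multiplied by the square
  root of m^2. Differentiability at the image time makes the chain rule available.\<close>

lemma speed_affine:
  assumes A: "smooth_atlas A"
    and "((snd (chart_at A (\<gamma> (m * s + k))) \<circ> \<gamma>) has_vector_derivative w) (at (m * s + k))"
  shows "speed A h (\<lambda>s. \<gamma> (m * s + k)) s = \<bar>m\<bar> * speed A h \<gamma> (m * s + k)"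
proof -
  define c where "c = chart_at A (\<gamma> (m * s + k))"
  have w: "((snd c \<circ> \<gamma>) has_vector_derivative w) (at (m * s + k))"
    using assms(2) unfolding c_def .
  have "((\<lambda>s. m * s + k) has_vector_derivative m) (at s)"
    by (auto intro!: derivative_eq_intros)
  then have "((snd c \<circ> \<gamma>) \<circ> (\<lambda>s. m * s + k) has_vector_derivative m *\<^sub>R w) (at s)"
    using w by (rule vector_diff_chain_at)
  then have "vector_derivative (snd c \<circ> (\<lambda>s. \<gamma> (m * s + k))) (at s) = m *\<^sub>R w"
    by (intro vector_derivative_at) (simp add: o_def)
  moreover have "vector_derivative (snd c \<circ> \<gamma>) (at (m * s + k)) = w"
    using w by (rule vector_derivative_at)
  moreover have "m *\<^sub>R w \<bullet> (H *v (m *\<^sub>R w)) = m\<^sup>2 * (w \<bullet> (H *v w))" for H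
    by (simp add: matrix_vector_mult_scaleR power2_eq_square)
  ultimately show ?thesis
    unfolding speed_def Let_def c_def[symmetric] by (simp add: real_sqrt_mult)
qed

text \<open>The factor \<open>\<bar>m\<bar>\<close> in the speed cancels the factor
  \<open>1 / \<bar>m\<bar>\<close> from the substitution in the integral.\<close>

lemma curve_length_affine:
  assumes A: "smooth_atlas A" and h: "riemannian_metric A h"
    and m: "m \<noteq> 0" and "a < b" and \<gamma>: "piecewise_C1_curve A \<gamma> a b"
    and img: "(\<lambda>s. m * s + k) ` {u..w} = {a..b}"
  shows "curve_length A h (\<lambda>s. \<gamma> (m * s + k)) u w = curve_length A h \<gamma> a b"
proof -
  obtain P where P: "finite P"
      "\<And>s c. s \<in> {a..b} - P \<Longrightarrow> c \<in> A \<Longrightarrow> \<gamma> s \<in> fst c \<Longrightarrow>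
        \<exists>w. ((snd c \<circ> \<gamma>) has_vector_derivative w) (at s)"
    using piecewise_C1_curve_differentiable[OF A \<open>a < b\<close> \<gamma>] by blast
  define Q where "Q = (\<lambda>s. m * s + k) -` P"
  have Q: "finite Q"
    unfolding Q_def by (rule finite_vimageI[OF P(1)]) (use m in \<open>simp add: inj_def\<close>)
  have "(speed A h \<gamma> has_integral curve_length A h \<gamma> a b) (cbox a b)"
    unfolding curve_length_def
    using piecewise_C1_curve_speed_integrable[OF A h \<open>a < b\<close> \<gamma>] by (simp add: has_integral_integral)
  from has_integral_affinity[OF this m, of k]
  have "((\<lambda>s. speed A h \<gamma> (m * s + k)) has_integral 1 / \<bar>m\<bar> * curve_length A h \<gamma> a b)
      ((\<lambda>s. 1 / m * s - 1 / m * k) ` {a..b})"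
    by simp
  moreover have "(\<lambda>s. 1 / m * s - 1 / m * k) ` {a..b} = {u..w}"
    unfolding img[symmetric] image_image using m by (simp add: field_simps)
  ultimately have "((\<lambda>s. \<bar>m\<bar> * speed A h \<gamma> (m * s + k)) has_integral
      \<bar>m\<bar> * (1 / \<bar>m\<bar> * curve_length A h \<gamma> a b)) {u..w}"
    by (intro has_integral_mult_right) simp
  \<comment> \<open>The scaling of the speed may fail at the preimages of break points, a finite set
    that does not affect the integral.\<close>
  then have "(speed A h (\<lambda>s. \<gamma> (m * s + k)) has_integral \<bar>m\<bar> * (1 / \<bar>m\<bar> * curve_length A h \<gamma> a b)) {u..w}"
  proof (rule has_integral_spike_finite[OF Q, rotated])
    fix s
    assume "s \<in> {u..w} - Q"
    then have "m * s + k \<in> {a..b} - P"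
      unfolding Q_def img[symmetric] by auto
    then show "speed A h (\<lambda>s. \<gamma> (m * s + k)) s = \<bar>m\<bar> * speed A h \<gamma> (m * s + k)"
      using P(2) chart_at[OF A] speed_affine[OF A] by blast
  qed
  then show ?thesis
    unfolding curve_length_def[of _ _ _ u] using m by (simp add: integral_unique)
qed

section \<open>Concatenation\<close>

lemma speed_cong:
  assumes "open N" "s \<in> N" "\<And>u. u \<in> N \<Longrightarrow> \<gamma> u = \<sigma> u"
  shows "speed A h \<gamma> s = speed A h \<sigma> s"
proof -
  have "\<gamma> s = \<sigma> s"
    using assms(2,3) by blast
  moreover have "eventually (\<lambda>u. u \<in> UNIV \<longrightarrow> (f \<circ> \<gamma>) u = (f \<circ> \<sigma>) u) (nhds s)"
    for f :: "'a \<Rightarrow> real^'b"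
    unfolding eventually_nhds using assms by (intro exI[of _ N]) simp
  ultimately show ?thesis
    unfolding speed_def Let_def
    using vector_derivative_cong_eq[of UNIV "f \<circ> \<gamma>" "f \<circ> \<sigma>" s s UNIV for f :: "'a \<Rightarrow> real^'b"] by simp
qed

text \<open>The junction \<open>b\<close> is added to the break points, so no C1 piece crosses it
  and each piece belongs to one of the two curves.\<close>

lemma piecewise_C1_curve_join:
  assumes "a < b" "b < c" and \<gamma>: "piecewise_C1_curve A \<gamma> a b" and \<sigma>: "piecewise_C1_curve A \<sigma> b c"
    and eq: "\<gamma> b = \<sigma> b"
  shows "piecewise_C1_curve A (\<lambda>s. if s \<le> b then \<gamma> s else \<sigma> s) a c" (is "piecewise_C1_curve A ?\<tau> a c")
proof -
  obtain P where P: "continuous_on {a..b} \<gamma>" "finite P"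
      "\<And>u w. a \<le> u \<and> u < w \<and> w \<le> b \<and> {u<..<w} \<inter> P = {} \<Longrightarrow> C1_curve A \<gamma> u w"
    using \<gamma> unfolding piecewise_C1_curve_iff[OF \<open>a < b\<close>] by blast
  obtain Q where Q: "continuous_on {b..c} \<sigma>" "finite Q"
      "\<And>u w. b \<le> u \<and> u < w \<and> w \<le> c \<and> {u<..<w} \<inter> Q = {} \<Longrightarrow> C1_curve A \<sigma> u w"
    using \<sigma> unfolding piecewise_C1_curve_iff[OF \<open>b < c\<close>] by blast
  have "C1_curve A ?\<tau> u w"
    if uw: "a \<le> u" "u < w" "w \<le> c" "{u<..<w} \<inter> insert b (P \<union> Q) = {}" for u w
  proof -
    have "w \<le> b \<or> b \<le> u" "{u<..<w} \<inter> P = {}" "{u<..<w} \<inter> Q = {}"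
      using uw(2,4) by (auto simp: disjoint_iff not_le)
    then consider "w \<le> b" "C1_curve A \<gamma> u w" | "b \<le> u" "C1_curve A \<sigma> u w"
      using P(3)[of u w] Q(3)[of u w] uw by auto
    then show ?thesis
    proof cases
      case 1
      then show ?thesis by (intro C1_curve_cong[of u w \<gamma> ?\<tau>]) auto
    next
      case 2
      have "\<sigma> s = ?\<tau> s" if "s \<in> {u..w}" for s
        using that 2(1) eq by (cases "s = b") auto
      then show ?thesis using 2(2) by (rule C1_curve_cong)
    qed
  qed
  moreover have "continuous_on ({a..b} \<union> {b..c}) ?\<tau>"
    by (rule continuous_on_If[OF closed_real_atLeastAtMost closed_real_atLeastAtMost P(1) Q(1)])
      (use eq in auto)
  moreover have "{a..b} \<union> {b..c} = {a..c}"
    using assms(1,2) by auto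
  moreover have "a < c"
    using assms(1,2) by simp
  ultimately show ?thesis
    unfolding piecewise_C1_curve_iff[OF \<open>a < c\<close>] using P(2) Q(2)
    by (intro conjI exI[of _ "insert b (P \<union> Q)"]) simp_all
qed

text \<open>Away from \<open>b\<close> the joined curve agrees with one of the two curves on an open
  half-line, so the speeds agree there; the single time \<open>b\<close> is negligible.\<close>

lemma curve_length_join:
  assumes A: "smooth_atlas A" and h: "riemannian_metric A h"
    and "a < b" "b < c" and \<gamma>: "piecewise_C1_curve A \<gamma> a b" and \<sigma>: "piecewise_C1_curve A \<sigma> b c"
    and eq: "\<gamma> b = \<sigma> b"
  shows "curve_length A h (\<lambda>s. if s \<le> b then \<gamma> s else \<sigma> s) a c
    = curve_length A h \<gamma> a b + curve_length A h \<sigma> b c" (is "curve_length A h ?\<tau> a c = _")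
proof -
  have "a < c" using assms(3,4) by simp
  have "speed A h ?\<tau> integrable_on {a..c}"
    by (rule piecewise_C1_curve_speed_integrable[OF A h \<open>a < c\<close> piecewise_C1_curve_join[OF assms(3-7)]])
  then have "curve_length A h ?\<tau> a c = curve_length A h ?\<tau> a b + curve_length A h ?\<tau> b c"
    unfolding curve_length_def
    using Henstock_Kurzweil_Integration.integral_combine[of a b c "speed A h ?\<tau>"] assms(3,4) by simp
  moreover have "curve_length A h ?\<tau> a b = curve_length A h \<gamma> a b"
    unfolding curve_length_def
  proof (rule integral_spike[of "{b}"])
    show "speed A h \<gamma> s = speed A h ?\<tau> s" if "s \<in> {a..b} - {b}" for s
      by (rule speed_cong[of "{..<b}"]) (use that in auto)
  qed simp
  moreover have "curve_length A h ?\<tau> b c = curve_length A h \<sigma> b c"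
    unfolding curve_length_def
  proof (rule integral_spike[of "{b}"])
    show "speed A h \<sigma> s = speed A h ?\<tau> s" if "s \<in> {b..c} - {b}" for s
      by (rule speed_cong[of "{b<..}"]) (use that in auto)
  qed simp
  ultimately show ?thesis by simp
qed


section \<open>The Riemannian distance\<close>

text \<open>The triangle inequality and symmetry are proved first for this set of lengths and then
  passed to the infimum.\<close>

definition curve_lengths ::
    "('m::topological_space, 'n::finite) chart set \<Rightarrow> ('m, 'n) tensor2 \<Rightarrow> 'm \<Rightarrow> 'm \<Rightarrow> real set" where
  "curve_lengths A h x y =
     {curve_length A h \<gamma> a b | \<gamma> a b. a < b \<and> piecewise_C1_curve A \<gamma> a b \<and> \<gamma> a = x \<and> \<gamma> b = y}"

lemma rdist_eq_Inf: "rdist A h x y = Inf (curve_lengths A h x y)"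
  unfolding rdist_def curve_lengths_def ..

lemma curve_lengthsI:
  "a < b \<Longrightarrow> piecewise_C1_curve A \<gamma> a b \<Longrightarrow> curve_length A h \<gamma> a b \<in> curve_lengths A h (\<gamma> a) (\<gamma> b)"
  unfolding curve_lengths_def by blast

lemma curve_lengthsE:
  assumes "l \<in> curve_lengths A h x y"
  obtains \<gamma> a b where "a < b" "piecewise_C1_curve A \<gamma> a b" "\<gamma> a = x" "\<gamma> b = y"
    "l = curve_length A h \<gamma> a b"
  using assms unfolding curve_lengths_def by blast

text \<open>For an arbitrary \<open>\<gamma>\<close> the speed need not be integrable; the integral
  then has the default value 0.\<close>

lemma curve_length_nonneg:
  assumes "smooth_atlas A" "riemannian_metric A h"
  shows "0 \<le> curve_length A h \<gamma> a b"
  using speed_nonneg[OF assms] unfolding curve_length_def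
  by (cases "speed A h \<gamma> integrable_on {a..b}")
    (auto intro: integral_nonneg simp: not_integrable_integral)

lemma curve_lengths_triangle:
  assumes A: "smooth_atlas A" and h: "riemannian_metric A h"
    and "l \<in> curve_lengths A h x y" "l' \<in> curve_lengths A h y z"
  shows "l + l' \<in> curve_lengths A h x z"
proof -
  obtain \<gamma> a b where \<gamma>: "a < b" "piecewise_C1_curve A \<gamma> a b" "\<gamma> a = x" "\<gamma> b = y"
      "l = curve_length A h \<gamma> a b"
    using assms(3) by (elim curve_lengthsE) blast
  obtain \<sigma> c d where \<sigma>: "c < d" "piecewise_C1_curve A \<sigma> c d" "\<sigma> c = y" "\<sigma> d = z"
      "l' = curve_length A h \<sigma> c d"
    using assms(4) by (elim curve_lengthsE) blast
  \<comment> \<open>The second curve is shifted in time to start at \<open>b\<close>, where the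
    first one ends.\<close>
  define e where "e = b + (d - c)"
  define \<sigma>' where "\<sigma>' = (\<lambda>s. \<sigma> (1 * s + (c - b)))"
  have e: "b < e"
    using \<sigma>(1) by (simp add: e_def)
  have img: "(\<lambda>s. 1 * s + (c - b)) ` {b..e} = {c..d}"
    by (simp add: e_def)
  have \<sigma>': "piecewise_C1_curve A \<sigma>' b e" "curve_length A h \<sigma>' b e = l'" "\<sigma>' b = y" "\<sigma>' e = z"
    unfolding \<sigma>'_def
    using piecewise_C1_curve_affine[OF _ \<sigma>(1) e \<sigma>(2) eq_refl[OF img]]
      curve_length_affine[OF A h _ \<sigma>(1,2) img] \<sigma>(3-5)
    by (simp_all add: e_def)
  have "piecewise_C1_curve A (\<lambda>s. if s \<le> b then \<gamma> s else \<sigma>' s) a e"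
    using piecewise_C1_curve_join[OF \<gamma>(1) e \<gamma>(2) \<sigma>'(1)] \<gamma>(4) \<sigma>'(3) by simp
  moreover have "curve_length A h (\<lambda>s. if s \<le> b then \<gamma> s else \<sigma>' s) a e = l + l'"
    using curve_length_join[OF A h \<gamma>(1) e \<gamma>(2) \<sigma>'(1)] \<gamma>(4,5) \<sigma>'(2,3) by simp
  ultimately show ?thesis
    using curve_lengthsI[of a e A "\<lambda>s. if s \<le> b then \<gamma> s else \<sigma>' s" h] \<gamma>(1,3) e \<sigma>'(4) by simp
qed

lemma curve_lengths_sym:
  assumes A: "smooth_atlas A" and h: "riemannian_metric A h"
    and "l \<in> curve_lengths A h x y"
  shows "l \<in> curve_lengths A h y x"
proof -
  obtain \<gamma> a b where \<gamma>: "a < b" "piecewise_C1_curve A \<gamma> a b" "\<gamma> a = x" "\<gamma> b = y"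
      "l = curve_length A h \<gamma> a b"
    using assms(3) by (elim curve_lengthsE) blast
  \<comment> \<open>The reversal about the midpoint maps \<open>[a, b]\<close> onto itself and
    exchanges its ends.\<close>
  have img: "(\<lambda>s. - 1 * s + (a + b)) ` {a..b} = {a..b}"
    using \<gamma>(1) image_affinity_atLeastAtMost[of "- 1" "a + b" a b] by simp
  show ?thesis
    using piecewise_C1_curve_affine[OF _ \<gamma>(1) \<gamma>(1) \<gamma>(2) eq_refl[OF img]]
      curve_length_affine[OF A h _ \<gamma>(1,2) img] \<gamma>(3-5)
      curve_lengthsI[OF \<gamma>(1), of A "\<lambda>s. \<gamma> (- 1 * s + (a + b))" h]
    by simp
qed

section \<open>Existence of connecting curves\<close>

text \<open>Seen in another chart, a coordinate segment is a transition map along a line; its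
  velocity is the directional derivative of that map, which \<open>transition_C1\<close> shows to be
  continuous.\<close>

lemma C1_curve_chart_segment:
  assumes A: "smooth_atlas A" and c: "c \<in> A"
    and seg: "\<And>s. s \<in> {0..1} \<Longrightarrow> z + s *\<^sub>R v \<in> chart_image c"
  shows "C1_curve A (\<lambda>s. chart_inv c (z + s *\<^sub>R v)) 0 1"
proof -
  define line where "line = (\<lambda>s::real. z + s *\<^sub>R v)"
  have cl: "continuous_on X line" for X
    unfolding line_def by (intro continuous_intros)
  have "\<exists>D. continuous_on {s\<in>{0..1}. chart_inv c (line s) \<in> fst c'} D \<and>
      (\<forall>s\<in>{s\<in>{0..1}. chart_inv c (line s) \<in> fst c'}.
        ((snd c' \<circ> (\<lambda>s. chart_inv c (line s))) has_vector_derivative D s)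
          (at s within {s\<in>{0..1}. chart_inv c (line s) \<in> fst c'}))" if c': "c' \<in> A" for c'
  proof -
    define \<tau> where "\<tau> = snd c' \<circ> chart_inv c"
    define S where "S = {s\<in>{0..1}. chart_inv c (line s) \<in> fst c'}"
    have S: "line s \<in> snd c ` (fst c \<inter> fst c')" if "s \<in> S" for s
    proof -
      have "line s \<in> chart_image c" "chart_inv c (line s) \<in> fst c'"
        using seg that by (auto simp: S_def line_def)
      then have "line s = snd c (chart_inv c (line s))" "chart_inv c (line s) \<in> fst c \<inter> fst c'"
        by (simp_all add: f_inv_into_f inv_into_into)
      then show ?thesis
        by (rule image_eqI)
    qed
    have "continuous_on S (\<lambda>s. frechet_derivative \<tau> (at (line s)) v)"
      using S unfolding \<tau>_def
      by (intro continuous_on_compose2[OF transition_C1(2)[OF A c c'] cl]) auto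
    moreover have "((snd c' \<circ> (\<lambda>s. chart_inv c (line s))) has_vector_derivative
        frechet_derivative \<tau> (at (line s)) v) (at s within S)" if s: "s \<in> S" for s
    proof -
      have "(line has_vector_derivative v) (at s within S)"
        unfolding line_def by (auto intro!: derivative_eq_intros)
      moreover have "(\<tau> has_derivative frechet_derivative \<tau> (at (line s))) (at (line s) within line ` S)"
        using transition_C1(1)[OF A c c' S[OF s]] unfolding \<tau>_def by (rule has_derivative_at_withinI)
      ultimately have "(\<tau> \<circ> line has_vector_derivative frechet_derivative \<tau> (at (line s)) v) (at s within S)"
        by (rule vector_derivative_diff_chain_within)
      then show ?thesis
        by (simp add: \<tau>_def o_def)
    qed
    ultimately show ?thesis
      unfolding S_def by (intro exI[of _ "\<lambda>s. frechet_derivative \<tau> (at (line s)) v"] conjI ballI) auto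
  qed
  moreover have "continuous_on {0..1} (\<lambda>s. chart_inv c (line s))"
    using smooth_atlasD(3)[OF A c] seg unfolding homeomorphism_def
    by (intro continuous_on_compose2[OF _ cl, of "chart_image c"]) (auto simp: line_def)
  ultimately show ?thesis
    unfolding C1_curve_iff line_def by blast
qed

text \<open>Inside a coordinate ball around \<open>p\<close>, each point is joined to
  \<open>p\<close> by a straight segment.\<close>

lemma curve_lengths_locally_nonempty:
  assumes A: "smooth_atlas A"
  obtains N where "open N" "p \<in> N" "\<And>q. q \<in> N \<Longrightarrow> curve_lengths A h p q \<noteq> {}"
proof -
  define c where "c = chart_at A p"
  have c: "c \<in> A" "p \<in> fst c"
    using chart_at[OF A] by (auto simp: c_def)
  note chart = smooth_atlasD[OF A c(1)]
  obtain e where e: "e > 0" "ball (snd c p) e \<subseteq> chart_image c"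
    using chart(2) c(2) open_contains_ball by blast
  have "open (fst c \<inter> snd c -` ball (snd c p) e)"
    using chart unfolding homeomorphism_def by (intro continuous_open_preimage) auto
  moreover have "curve_lengths A h p q \<noteq> {}" if q: "q \<in> fst c \<inter> snd c -` ball (snd c p) e" for q
  proof -
    define v where "v = snd c q - snd c p"
    have "snd c p + s *\<^sub>R v \<in> ball (snd c p) e" if s: "s \<in> {0..1}" for s
    proof -
      have "norm (s *\<^sub>R v) \<le> 1 * norm v"
        unfolding norm_scaleR by (rule mult_right_mono) (use s in auto)
      also have "\<dots> < e"
        using q by (simp add: v_def dist_norm norm_minus_commute)
      finally show ?thesis by (simp add: dist_norm)
    qed
    then have C1: "C1_curve A (\<lambda>s. chart_inv c (snd c p + s *\<^sub>R v)) 0 1" (is "C1_curve A ?\<gamma> 0 1")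
      using e(2) by (intro C1_curve_chart_segment[OF A c(1)]) blast
    have "C1_curve A ?\<gamma> u w" if "0 \<le> u \<and> u < w \<and> w \<le> 1 \<and> {u<..<w} \<inter> {} = {}" for u w
      using that by (intro C1_curve_subinterval[OF C1]) simp
    then have pw: "piecewise_C1_curve A ?\<gamma> 0 1"
      using C1 unfolding piecewise_C1_curve_iff[OF zero_less_one]
      by (intro conjI exI[of _ "{}"]) (simp_all add: C1_curve_iff)
    have "?\<gamma> 0 = p" "?\<gamma> 1 = q"
      using chart(3) c(2) q unfolding homeomorphism_def v_def by auto
    then show ?thesis
      using curve_lengthsI[OF zero_less_one pw, of h] by auto
  qed
  ultimately show ?thesis
    using that c(2) e(1) by (metis IntI centre_in_ball vimageI)
qed

text \<open>The set of points reachable from \<open>x\<close> is open, closed and nonempty.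
  Nonemptiness of the set of lengths gives the infimum in \<open>rdist\<close> its intended
  meaning.\<close>

lemma curve_lengths_nonempty:
  fixes A :: "('m::topological_space, 'n::finite) chart set"
  assumes A: "smooth_atlas A" and h: "riemannian_metric A h" and conn: "connected (UNIV :: 'm set)"
  shows "curve_lengths A h x y \<noteq> {}"
proof -
  define R where "R = {y. curve_lengths A h x y \<noteq> {}}"
  have trans: "curve_lengths A h u w \<noteq> {}"
    if "curve_lengths A h u v \<noteq> {}" "curve_lengths A h v w \<noteq> {}" for u v w
    using curve_lengths_triangle[OF A h, of _ u v _ w] that by blast
  have sym: "curve_lengths A h w u \<noteq> {}" if "curve_lengths A h u w \<noteq> {}" for u w
    using curve_lengths_sym[OF A h, of _ u w] that by blast
  have "\<exists>N. open N \<and> u \<in> N \<and> N \<subseteq> R" if u: "u \<in> R" for u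
  proof -
    obtain N where N: "open N" "u \<in> N" "\<And>q. q \<in> N \<Longrightarrow> curve_lengths A h u q \<noteq> {}"
      using curve_lengths_locally_nonempty[OF A, of u h] by blast
    have "q \<in> R" if "q \<in> N" for q
      using trans[OF _ N(3)[OF that]] u unfolding R_def by simp
    then show ?thesis
      using N(1,2) by blast
  qed
  then have "open R"
    by (subst open_subopen) blast
  \<comment> \<open>If a point near \<open>u\<close> were reachable, going back along a reversed
    short curve would reach \<open>u\<close>.\<close>
  moreover have "\<exists>N. open N \<and> u \<in> N \<and> N \<subseteq> - R" if u: "u \<in> - R" for u
  proof -
    obtain N where N: "open N" "u \<in> N" "\<And>q. q \<in> N \<Longrightarrow> curve_lengths A h u q \<noteq> {}"
      using curve_lengths_locally_nonempty[OF A, of u h] by blast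
    have "q \<notin> R" if "q \<in> N" for q
      using trans[OF _ sym[OF N(3)[OF that]]] u unfolding R_def by auto
    then show ?thesis
      using N(1,2) by blast
  qed
  then have "open (- R)"
    by (subst open_subopen) blast
  \<comment> \<open>The neighbourhood supplied by the local lemma contains its own centre, so some
    curve joins \<open>x\<close> to itself.\<close>
  moreover have "x \<in> R"
    unfolding R_def mem_Collect_eq by (rule curve_lengths_locally_nonempty[OF A, of x h]) simp
  ultimately have "R = UNIV"
    using conn connectedD[of UNIV R "- R"] by blast
  then show ?thesis
    unfolding R_def by blast
qed

section \<open>From lengths to the distance\<close>

lemma rdist_le:
  assumes "smooth_atlas A" "riemannian_metric A h" "l \<in> curve_lengths A h x y"
  shows "rdist A h x y \<le> l"
  unfolding rdist_eq_Inf
proof (rule cInf_lower[OF assms(3)])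
  show "bdd_below (curve_lengths A h x y)"
    using curve_length_nonneg[OF assms(1,2)]
    by (intro bdd_belowI[of _ 0]) (auto elim!: curve_lengthsE)
qed

text \<open>Connectedness enters here: it makes the set of lengths nonempty, as a lower bound for
  the infimum requires.\<close>

lemma le_rdist:
  fixes A :: "('m::topological_space, 'n::finite) chart set"
  assumes "smooth_atlas A" "riemannian_metric A h" "connected (UNIV :: 'm set)"
    and "\<And>l. l \<in> curve_lengths A h x y \<Longrightarrow> e \<le> l"
  shows "e \<le> rdist A h x y"
  unfolding rdist_eq_Inf using curve_lengths_nonempty[OF assms(1-3)] assms(4) by (rule cInf_greatest)

lemma rdist_nonneg:
  fixes A :: "('m::topological_space, 'n::finite) chart set"
  assumes "smooth_atlas A" "riemannian_metric A h" "connected (UNIV :: 'm set)"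
  shows "0 \<le> rdist A h x y"
  by (rule le_rdist[OF assms]) (auto elim!: curve_lengthsE intro: curve_length_nonneg[OF assms(1,2)])

lemma rdist_sym:
  assumes "smooth_atlas A" "riemannian_metric A h"
  shows "rdist A h x y = rdist A h y x"
  unfolding rdist_eq_Inf using curve_lengths_sym[OF assms] by (intro arg_cong[of _ _ Inf]) blast

text \<open>With a second curve fixed, the infimum is taken over first curves; then it is taken over
  second curves.\<close>

lemma rdist_triangle:
  fixes A :: "('m::topological_space, 'n::finite) chart set"
  assumes "smooth_atlas A" "riemannian_metric A h" "connected (UNIV :: 'm set)"
  shows "rdist A h x z \<le> rdist A h x y + rdist A h y z"
proof -
  have "rdist A h x z - l \<le> rdist A h x y" if l: "l \<in> curve_lengths A h y z" for l
  proof (rule le_rdist[OF assms])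
    fix l'
    assume "l' \<in> curve_lengths A h x y"
    then show "rdist A h x z - l \<le> l'"
      using rdist_le[OF assms(1,2) curve_lengths_triangle[OF assms(1,2) _ l]] by fastforce
  qed
  then have "rdist A h x z - rdist A h x y \<le> rdist A h y z"
    by (intro le_rdist[OF assms]) (simp add: algebra_simps)
  then show ?thesis by simp
qed


section \<open>Comparison of distances\<close>

text \<open>The constants compare quadratic forms and so enter lengths through their square
  roots.\<close>

lemma curve_length_le:
  assumes A: "smooth_atlas A" and h: "riemannian_metric A h" and k: "riemannian_metric A k"
    and \<gamma>: "a < b" "piecewise_C1_curve A \<gamma> a b"
    and le: "\<And>s. s \<in> {a..b} \<Longrightarrow> metric_le_at A (\<gamma> s) \<alpha> h \<beta> k"
  shows "sqrt \<alpha> * curve_length A h \<gamma> a b \<le> sqrt \<beta> * curve_length A k \<gamma> a b"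
proof -
  have "integral {a..b} (\<lambda>s. sqrt \<alpha> * speed A h \<gamma> s) \<le> integral {a..b} (\<lambda>s. sqrt \<beta> * speed A k \<gamma> s)"
    using piecewise_C1_curve_speed_integrable[OF A h \<gamma>] piecewise_C1_curve_speed_integrable[OF A k \<gamma>]
    by (intro integral_le integrable_on_mult_right speed_le[OF A] le)
  then show ?thesis
    by (simp add: curve_length_def)
qed

lemma rdist_curve_less:
  fixes A :: "('m::topological_space, 'n::finite) chart set"
  assumes A: "smooth_atlas A" and h: "riemannian_metric A h" and conn: "connected (UNIV :: 'm set)"
    and \<gamma>: "a < b" "piecewise_C1_curve A \<gamma> a b"
    and "rdist A h p (\<gamma> a) < \<rho>" and s: "s \<in> {a..b}"
  shows "rdist A h p (\<gamma> s) < \<rho> + curve_length A h \<gamma> a s"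
proof (cases "s = a")
  \<comment> \<open>A single time is not a parameter interval of a curve in \<open>rdist\<close>, so
    the start is treated separately.\<close>
  case True
  then show ?thesis
    using assms(6) by (simp add: curve_length_def)
next
  case False
  then have as: "a < s" "s \<le> b"
    using s by auto
  have "rdist A h (\<gamma> a) (\<gamma> s) \<le> curve_length A h \<gamma> a s"
    using piecewise_C1_curve_subinterval[OF \<gamma>(2) order_refl as]
    by (intro rdist_le[OF A h] curve_lengthsI as)
  then show ?thesis
    using rdist_triangle[OF A h conn, of p "\<gamma> s" "\<gamma> a"] assms(6) by linarith
qed

text \<open>The curve may leave the ball on which the metrics are comparable. It is therefore
  stopped once its \<open>h\<close>-length reaches \<open>l\<close>; dropping the rest only
  decreases its \<open>k\<close>-length.\<close>

lemma min_curve_length_le: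
  fixes A :: "('m::topological_space, 'n::finite) chart set"
  assumes A: "smooth_atlas A" and h: "riemannian_metric A h" and k: "riemannian_metric A k"
    and conn: "connected (UNIV :: 'm set)"
    and \<gamma>: "a < b" "piecewise_C1_curve A \<gamma> a b"
    and p: "rdist A h p (\<gamma> a) < \<rho>" and l: "0 < l" "\<rho> + l \<le> \<sigma>" and "0 \<le> \<beta>"
    and le: "\<And>q. q \<in> rball A h p \<sigma> \<Longrightarrow> metric_le_at A q \<alpha> h \<beta> k"
  shows "sqrt \<alpha> * min (curve_length A h \<gamma> a b) l \<le> sqrt \<beta> * curve_length A k \<gamma> a b"
proof -
  define F where "F s = curve_length A h \<gamma> a s" for s
  note int_h = piecewise_C1_curve_speed_integrable[OF A h \<gamma>]
  note int_k = piecewise_C1_curve_speed_integrable[OF A k \<gamma>]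
  have "continuous_on {a..b} F"
    unfolding F_def curve_length_def by (rule indefinite_integral_continuous_1[OF int_h])
  moreover have "F a = 0"
    by (simp add: F_def curve_length_def)
  moreover have "0 \<le> F b"
    unfolding F_def by (rule curve_length_nonneg[OF A h])
  \<comment> \<open>The stopping time comes from the intermediate value theorem; if the total
    \<open>h\<close>-length is at most \<open>l\<close>, the value \<open>F b\<close> is attained
    instead.\<close>
  ultimately obtain c where c: "a \<le> c" "c \<le> b" "F c = min (F b) l"
    using IVT'[of F a "min (F b) l" b] \<gamma>(1) l(1) by auto
  show ?thesis
  proof (cases "c = a")
    case True
    then have "min (F b) l = 0"
      using c(3) \<open>F a = 0\<close> by simp
    then show ?thesis
      using curve_length_nonneg[OF A k, of \<gamma> a b] \<open>0 \<le> \<beta>\<close> by (simp add: F_def)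
  next
    case False
    then have "a < c"
      using c(1) by simp
    \<comment> \<open>Before the stopping time the distance from \<open>p\<close> is less than
      \<open>\<rho> + F s\<close>, and \<open>F s \<le> F c \<le> l\<close>.\<close>
    have "\<gamma> s \<in> rball A h p \<sigma>" if s: "s \<in> {a..c}" for s
    proof -
      have "F s \<le> F c"
        unfolding F_def curve_length_def using s c(2)
        by (intro integral_subset_le integrable_subinterval_real[OF int_h] speed_nonneg[OF A h] ballI) auto
      then show ?thesis
        using rdist_curve_less[OF A h conn \<gamma> p, of s] s c(2,3) l(2) unfolding F_def rball_def by simp
    qed
    then have "sqrt \<alpha> * F c \<le> sqrt \<beta> * curve_length A k \<gamma> a c"
      unfolding F_def using piecewise_C1_curve_subinterval[OF \<gamma>(2) order_refl \<open>a < c\<close> c(2)]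
      by (intro curve_length_le[OF A h k \<open>a < c\<close>] le)
    also have "curve_length A k \<gamma> a c \<le> curve_length A k \<gamma> a b"
      unfolding curve_length_def using c
      by (intro integral_subset_le integrable_subinterval_real[OF int_k] speed_nonneg[OF A k] ballI) auto
    then have "sqrt \<beta> * curve_length A k \<gamma> a c \<le> sqrt \<beta> * curve_length A k \<gamma> a b"
      using \<open>0 \<le> \<beta>\<close> by (intro mult_left_mono) simp_all
    finally show ?thesis
      using c(3) by (simp add: F_def)
  qed
qed

text \<open>Every competitor for the \<open>k\<close>-distance must be bounded below, including
  those that leave the ball. The cut-off \<open>2 * \<rho>\<close> is large enough to dominate the
  \<open>h\<close>-distance of \<open>x\<close> and \<open>y\<close>, and keeps the initial piece in
  the ball of radius \<open>3 * \<rho>\<close>.\<close>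

lemma rdist_le_rdist:
  fixes A :: "('m::topological_space, 'n::finite) chart set"
  assumes A: "smooth_atlas A" and h: "riemannian_metric A h" and k: "riemannian_metric A k"
    and conn: "connected (UNIV :: 'm set)"
    and xy: "x \<in> rball A h p \<rho>" "y \<in> rball A h p \<rho>" and \<sigma>: "3 * \<rho> \<le> \<sigma>" and "0 \<le> \<alpha>" "0 < \<beta>"
    and le: "\<And>q. q \<in> rball A h p \<sigma> \<Longrightarrow> metric_le_at A q \<alpha> h \<beta> k"
  shows "sqrt \<alpha> * rdist A h x y \<le> sqrt \<beta> * rdist A k x y"
proof -
  have near: "rdist A h p x < \<rho>" "rdist A h p y < \<rho>"
    using xy by (simp_all add: rball_def)
  have "0 < \<rho>"
    using rdist_nonneg[OF A h conn, of p x] near by linarith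
  have dist: "rdist A h x y \<le> 2 * \<rho>"
    using rdist_triangle[OF A h conn, of x y p] rdist_sym[OF A h, of x p] near by linarith
  have bound: "sqrt \<alpha> * rdist A h x y \<le> sqrt \<beta> * l" if l: "l \<in> curve_lengths A k x y" for l
  proof -
    obtain \<gamma> a b where \<gamma>: "a < b" "piecewise_C1_curve A \<gamma> a b" "\<gamma> a = x" "\<gamma> b = y"
        "l = curve_length A k \<gamma> a b"
      using l by (elim curve_lengthsE) blast
    have "rdist A h x y \<le> min (curve_length A h \<gamma> a b) (2 * \<rho>)"
      using rdist_le[OF A h curve_lengthsI[OF \<gamma>(1,2)]] \<gamma>(3,4) dist by simp
    then have "sqrt \<alpha> * rdist A h x y \<le> sqrt \<alpha> * min (curve_length A h \<gamma> a b) (2 * \<rho>)"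
      using \<open>0 \<le> \<alpha>\<close> by (intro mult_left_mono) simp_all
    also have "\<dots> \<le> sqrt \<beta> * curve_length A k \<gamma> a b"
      by (rule min_curve_length_le[OF A h k conn \<gamma>(1,2) _ _ _ less_imp_le[OF \<open>0 < \<beta>\<close>] le])
        (use near \<gamma>(3) \<open>0 < \<rho>\<close> \<sigma> in auto)
    finally show ?thesis
      using \<gamma>(5) by simp
  qed
  have "sqrt \<alpha> * rdist A h x y / sqrt \<beta> \<le> rdist A k x y"
    using bound \<open>0 < \<beta>\<close> by (intro le_rdist[OF A k conn]) (simp add: field_simps)
  then show ?thesis
    using \<open>0 < \<beta>\<close> by (simp add: field_simps)
qed

text \<open>Here the competitors are \<open>h\<close>-curves and may be restricted to those shorter
  than \<open>2 * \<rho>\<close>, which stay in the larger ball as a whole.\<close>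

lemma rdist_ge_rdist:
  fixes A :: "('m::topological_space, 'n::finite) chart set"
  assumes A: "smooth_atlas A" and h: "riemannian_metric A h" and k: "riemannian_metric A k"
    and conn: "connected (UNIV :: 'm set)"
    and xy: "x \<in> rball A h p \<rho>" "y \<in> rball A h p \<rho>" and \<sigma>: "3 * \<rho> \<le> \<sigma>" and "0 \<le> \<alpha>" "0 < \<beta>"
    and le: "\<And>q. q \<in> rball A h p \<sigma> \<Longrightarrow> metric_le_at A q \<alpha> k \<beta> h"
  shows "sqrt \<alpha> * rdist A k x y \<le> sqrt \<beta> * rdist A h x y"
proof -
  have near: "rdist A h p x < \<rho>" "rdist A h p y < \<rho>"
    using xy by (simp_all add: rball_def)
  have dist: "rdist A h x y < 2 * \<rho>"
    using rdist_triangle[OF A h conn, of x y p] rdist_sym[OF A h, of x p] near by linarith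
  have bound: "sqrt \<alpha> * rdist A k x y \<le> sqrt \<beta> * l" if l: "l \<in> curve_lengths A h x y" "l < 2 * \<rho>" for l
  proof -
    obtain \<gamma> a b where \<gamma>: "a < b" "piecewise_C1_curve A \<gamma> a b" "\<gamma> a = x" "\<gamma> b = y"
        "l = curve_length A h \<gamma> a b"
      using l(1) by (elim curve_lengthsE) blast
    have "\<gamma> s \<in> rball A h p \<sigma>" if s: "s \<in> {a..b}" for s
    proof -
      have "curve_length A h \<gamma> a s \<le> curve_length A h \<gamma> a b"
        unfolding curve_length_def using s piecewise_C1_curve_speed_integrable[OF A h \<gamma>(1,2)]
        by (intro integral_subset_le speed_nonneg[OF A h] ballI)
          (auto elim: integrable_subinterval_real)
      then show ?thesis
        using rdist_curve_less[OF A h conn \<gamma>(1,2) _ s, of p \<rho>] near \<gamma>(3,5) l(2) \<sigma>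
        unfolding rball_def by simp
    qed
    then have "sqrt \<alpha> * curve_length A k \<gamma> a b \<le> sqrt \<beta> * l"
      unfolding \<gamma>(5) by (intro curve_length_le[OF A k h \<gamma>(1,2)] le)
    moreover have "sqrt \<alpha> * rdist A k x y \<le> sqrt \<alpha> * curve_length A k \<gamma> a b"
      using rdist_le[OF A k curve_lengthsI[OF \<gamma>(1,2)]] \<gamma>(3,4) \<open>0 \<le> \<alpha>\<close>
      by (intro mult_left_mono) simp_all
    ultimately show ?thesis by linarith
  qed
  have "sqrt \<alpha> * rdist A k x y / sqrt \<beta> \<le> rdist A h x y"
  \<comment> \<open>Since the \<open>h\<close>-distance is strictly below \<open>2 * \<rho>\<close>,
    some connecting curve is shorter than both \<open>e\<close> and
    \<open>2 * \<rho>\<close>.\<close>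
  proof (rule dense_ge)
    fix e
    assume "rdist A h x y < e"
    then have "rdist A h x y < min e (2 * \<rho>)"
      using dist by simp
    then obtain l where "l \<in> curve_lengths A h x y" "l < min e (2 * \<rho>)"
      using cInf_lessD[OF curve_lengths_nonempty[OF A h conn]] unfolding rdist_eq_Inf by blast
    then have "sqrt \<alpha> * rdist A k x y \<le> sqrt \<beta> * l" "sqrt \<beta> * l \<le> sqrt \<beta> * e"
      using bound[of l] \<open>0 < \<beta>\<close> by (simp_all add: mult_left_mono)
    then have "sqrt \<alpha> * rdist A k x y \<le> sqrt \<beta> * e"
      by linarith
    then show "sqrt \<alpha> * rdist A k x y / sqrt \<beta> \<le> e"
      using \<open>0 < \<beta>\<close> by (simp add: field_simps)
  qed
  then show ?thesis
    using \<open>0 < \<beta>\<close> by (simp add: field_simps)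
qed

section \<open>Application to the Ricci flow\<close>

theorem corollary4p10:
  fixes A :: "('m::t2_space, 4) chart set"
    and g :: "real \<Rightarrow> ('m, 4) tensor2"
    and T R v \<epsilon>\<^sub>0 :: real
  assumes "closed_manifold A"
    and "0 < T"
    and "ricci_flow A T g"
    and "\<forall>t\<in>{0..<T}. \<forall>p. \<bar>scalar_curv A (g t) p\<bar> \<le> 1"
    and "regularity_constants A T g R v \<epsilon>\<^sub>0"
  shows "\<forall>t\<in>{0<..<T} \<inter> {T - v<..<T}. good_time A T g t \<longrightarrow>
    (\<forall>p\<in>Reg_at A T g R \<epsilon>\<^sub>0 t. \<forall>r\<in>{t..<T}. \<forall>s\<in>{t..<T}.
      \<forall>x\<in>rball A (g t) p (R / 200 * sqrt (T - t)).
      \<forall>y\<in>rball A (g t) p (R / 200 * sqrt (T - t)).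
        1/8 * rdist A (g r) x y \<le> rdist A (g s) x y \<and>
        rdist A (g s) x y \<le> 8 * rdist A (g r) x y)"
proof (intro ballI impI)
  fix t p r s x y
  assume t: "t \<in> {0<..<T} \<inter> {T - v<..<T}" and good: "good_time A T g t"
    and p: "p \<in> Reg_at A T g R \<epsilon>\<^sub>0 t" and r: "r \<in> {t..<T}" and s: "s \<in> {t..<T}"
    and x: "x \<in> rball A (g t) p (R / 200 * sqrt (T - t))"
    and y: "y \<in> rball A (g t) p (R / 200 * sqrt (T - t))"
  have A: "smooth_atlas A" and conn: "connected (UNIV :: 'm set)"
    using assms(1) by (simp_all add: closed_manifold_def)
  have metric: "riemannian_metric A (g u)" if "u \<in> {t..<T}" for u
    using assms(3) that t unfolding ricci_flow_def by auto
  have tt: "t \<in> {t..<T}"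
    using t by simp
  have "R > 0"
    using assms(5) by (simp add: regularity_constants_def)
  \<comment> \<open>Tripling the radius stays inside the region of metric control, since 3/200 is at
    most 1/2.\<close>
  then have R: "3 * (R / 200 * sqrt (T - t)) \<le> R / 2 * sqrt (T - t)"
    using t by simp
  have const: "\<forall>q\<in>rball A (g t) p (R / 2 * sqrt (T - t)). \<forall>u\<in>{t..<T}. \<forall>w\<in>{t..<T}.
      metric_le_at A q (1/2) (g u) 1 (g w) \<and> metric_le_at A q 1 (g w) 2 (g u)"
  proof -
    have "t \<in> {0<..<T}" "\<bar>T - t\<bar> \<le> v"
      using t by auto
    then show ?thesis
      using assms(5) good p unfolding regularity_constants_def Let_def by blast
  qed
  \<comment> \<open>Both balls are taken with respect to \<open>g t\<close>, so \<open>g t\<close>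
    is the reference metric \<open>h\<close> in both comparison lemmas.\<close>
  have upper: "rdist A (g u) x y \<le> sqrt 2 * rdist A (g t) x y" if u: "u \<in> {t..<T}" for u
    using rdist_ge_rdist[OF A metric[OF tt] metric[OF u] conn x y R, of 1 2] const u tt by simp
  have lower: "rdist A (g t) x y \<le> sqrt 2 * rdist A (g u) x y" if u: "u \<in> {t..<T}" for u
    using rdist_le_rdist[OF A metric[OF tt] metric[OF u] conn x y R, of 1 2] const u tt by simp
  have compare: "rdist A (g u) x y \<le> 8 * rdist A (g w) x y" if u: "u \<in> {t..<T}" and w: "w \<in> {t..<T}" for u w
  proof -
    have "rdist A (g u) x y \<le> sqrt 2 * (sqrt 2 * rdist A (g w) x y)"
      by (rule order_trans[OF upper[OF u] mult_left_mono[OF lower[OF w]]]) simp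
    also have "\<dots> = 2 * rdist A (g w) x y"
      by simp
    \<comment> \<open>Weakening the factor 2 to 8 uses that the distance is nonnegative.\<close>
    finally show ?thesis
      using rdist_nonneg[OF A metric[OF w] conn, of x y] by simp
  qed
  show "1/8 * rdist A (g r) x y \<le> rdist A (g s) x y \<and> rdist A (g s) x y \<le> 8 * rdist A (g r) x y"
    using compare[OF r s] compare[OF s r] by simp
qed

end
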